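(* Let $\epsilon>0$ and $\eta>0$. Let $m$ solve the stochastic differential equation $$\frac{dm}{dt}=-Am-B(m,m)+f+\frac1\eta P(v-m)+\frac{\epsilon}{\eta}P\frac{dw}{dt}$$ (the continuous time 3DVAR filter), where $w$ is an $\mathbb{R}^3$-valued standard Brownian motion and $m(0)\in\mathbb{R}^3$ is deterministic, and let $v$ solve the Lorenz equation $\frac{dv}{dt}+Av+B(v,v)=f$ with initial data $v(0)\in\mathcal{A}$, the global attractor, so that $\sup_{t\ge0}|v(t)|^2\le K$. If $\eta K<4$ then, for all $t\ge 0$, $$\mathbb{E}|m(t)-v(t)|^2\le e^{-\lambda t}|m(0)-v(0)|^2+\frac{\epsilon^2}{\eta^2\lambda}\big(1-e^{-\lambda t}\big),$$ where $$\lambda=2\Big(1-\frac{\eta K}{4}\Big).$$ Thus $$\limsup_{t\to\infty}\mathbb{E}|m(t)-v(t)|^2\le\frac{\epsilon^2}{\lambda\eta^2}.$$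
   Context: Fix parameters $\alpha>1$, $b>1$, $r>0$. The Lorenz '63 equation (in shifted coordinates) is the ODE in $\mathbb{R}^3$, $u=(u_x,u_y,u_z)$, $$\frac{du}{dt}+Au+B(u,u)=f,$$ where $$A=\begin{pmatrix}\alpha&-\alpha&0\\ \alpha&1&0\\ 0&0&b\end{pmatrix},\quad f=\begin{pmatrix}0\\0\\-b(r+\alpha)\end{pmatrix},\quad B(u,\tilde u)=\begin{pmatrix}0\\ (u_x\tilde u_z+u_z\tilde u_x)/2\\ -(u_x\tilde u_y+u_y\tilde u_x)/2\end{pmatrix}.$$ It has a global attractor $\mathcal{A}\subset\mathbb{R}^3$, and every trajectory $u$ starting in $\mathcal A$ satisfies $|u(t)|^2\le K$ for all $t$, where $K=\frac{b^2(r+\alpha)^2}{4(b-1)}$. $|\cdot|$ is the Euclidean norm and $P=\mathrm{diag}(1,0,0)$. The SDE is understood in the Itô sense; it has a unique global strong solution $m\in C([0,\infty);\mathbb{R}^3)$. *)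

theory Defs
  imports "HOL-Probability.Probability"
begin

section \<open>The Lorenz '63 equation\<close>

definition lorenz_A :: "real \<Rightarrow> real \<Rightarrow> real^3^3" where
  "lorenz_A \<alpha> b = vector [vector [\<alpha>, -\<alpha>, 0], vector [\<alpha>, 1, 0], vector [0, 0, b]]"

definition lorenz_B :: "real^3 \<Rightarrow> real^3 \<Rightarrow> real^3" where
  "lorenz_B u u' = vector [0, (u$1 * u'$3 + u$3 * u'$1) / 2, - (u$1 * u'$2 + u$2 * u'$1) / 2]"

definition lorenz_f :: "real \<Rightarrow> real \<Rightarrow> real \<Rightarrow> real^3" where
  "lorenz_f \<alpha> b r = vector [0, 0, - b * (r + \<alpha>)]"

definition lorenz_solution :: "real \<Rightarrow> real \<Rightarrow> real \<Rightarrow> (real \<Rightarrow> real^3) \<Rightarrow> bool" where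
  "lorenz_solution \<alpha> b r u \<longleftrightarrow>
     (\<forall>t\<ge>0. (u has_vector_derivative
        (- (lorenz_A \<alpha> b *v u t) - lorenz_B (u t) (u t) + lorenz_f \<alpha> b r)) (at t within {0..}))"

text \<open>The image \<open>S(t) E\<close> of a set of initial states under the solution semigroup.\<close>

definition lorenz_flow_image :: "real \<Rightarrow> real \<Rightarrow> real \<Rightarrow> real \<Rightarrow> (real^3) set \<Rightarrow> (real^3) set" where
  "lorenz_flow_image \<alpha> b r t E = {u t | u. lorenz_solution \<alpha> b r u \<and> u 0 \<in> E}"

text \<open>The global attractor is the compact invariant set that attracts every bounded set of initial
  states; these properties determine it uniquely.  Attraction is written with explicit
  \<open>\<epsilon>\<close> rather than through \<^const>\<open>infdist\<close>, which is 0 for the empty set.\<close>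

definition lorenz_global_attractor :: "real \<Rightarrow> real \<Rightarrow> real \<Rightarrow> (real^3) set \<Rightarrow> bool" where
  "lorenz_global_attractor \<alpha> b r \<A> \<longleftrightarrow>
     compact \<A> \<and>
     (\<forall>t\<ge>0. lorenz_flow_image \<alpha> b r t \<A> = \<A>) \<and>
     (\<forall>E. bounded E \<longrightarrow>
        (\<forall>\<epsilon>>0. \<exists>T\<ge>0. \<forall>t\<ge>T. \<forall>x\<in>lorenz_flow_image \<alpha> b r t E. \<exists>a\<in>\<A>. dist x a < \<epsilon>))"


section \<open>Brownian motion\<close>

text \<open>A standard \<open>\<real>\<^sup>n\<close>-valued Brownian motion with respect to a filtration \<open>F\<close>; only the times
  \<open>t \<ge> 0\<close> matter.  Increments over \<open>[s, t]\<close> are independent of \<open>F s\<close> and have law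
  \<open>N(0, (t - s) I)\<close>, i.e. independent \<open>N(0, t - s)\<close> coordinates.\<close>

definition standard_brownian_motion ::
    "'a measure \<Rightarrow> (real \<Rightarrow> 'a measure) \<Rightarrow> (real \<Rightarrow> 'a \<Rightarrow> real^'n) \<Rightarrow> bool" where
  "standard_brownian_motion M F w \<longleftrightarrow>
     (\<forall>t\<ge>0. w t \<in> borel_measurable (F t)) \<and>
     (AE \<omega> in M. w 0 \<omega> = 0) \<and>
     (AE \<omega> in M. continuous_on {0..} (\<lambda>t. w t \<omega>)) \<and>
     (\<forall>s t. 0 \<le> s \<and> s < t \<longrightarrow>
        prob_space.indep_set M (sets (F s))
          {(\<lambda>\<omega>. w t \<omega> - w s \<omega>) -` C \<inter> space M | C. C \<in> sets borel} \<and>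
        prob_space.indep_vars M (\<lambda>_. borel) (\<lambda>i \<omega>. (w t \<omega> - w s \<omega>) $ i) UNIV \<and>
        (\<forall>i. distributed M lborel (\<lambda>\<omega>. (w t \<omega> - w s \<omega>) $ i) (normal_density 0 (sqrt (t - s)))))"


section \<open>The continuous time 3DVAR filter\<close>

definition proj_P :: "real^3^3" where
  "proj_P = vector [vector [1, 0, 0], vector [0, 0, 0], vector [0, 0, 0]]"

text \<open>A continuous solution, adapted to \<open>F\<close>, of the stochastic differential equation in
  integral form.  The diffusion coefficient \<open>(\<epsilon>/\<eta>) P\<close> is constant, so its Ito integral
  over \<open>[0, t]\<close> is \<open>(\<epsilon>/\<eta>) P (w(t) - w(0))\<close>.  With \<open>F\<close> the augmented filtration
  generated by \<open>w\<close> this is a strong solution.\<close>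

definition threedvar_solution ::
    "real \<Rightarrow> real \<Rightarrow> real \<Rightarrow> real \<Rightarrow> real \<Rightarrow> 'a measure \<Rightarrow> (real \<Rightarrow> 'a measure) \<Rightarrow>
     (real \<Rightarrow> 'a \<Rightarrow> real^3) \<Rightarrow> (real \<Rightarrow> real^3) \<Rightarrow> (real \<Rightarrow> 'a \<Rightarrow> real^3) \<Rightarrow> bool" where
  "threedvar_solution \<alpha> b r \<epsilon> \<eta> M F w v m \<longleftrightarrow>
     (\<forall>t\<ge>0. m t \<in> borel_measurable (F t)) \<and>
     (AE \<omega> in M. continuous_on {0..} (\<lambda>t. m t \<omega>)) \<and>
     (AE \<omega> in M. \<forall>t\<ge>0.
        m t \<omega> = m 0 \<omega>
          + integral {0..t} (\<lambda>s. - (lorenz_A \<alpha> b *v m s \<omega>) - lorenz_B (m s \<omega>) (m s \<omega>)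
              + lorenz_f \<alpha> b r + (1 / \<eta>) *\<^sub>R (proj_P *v (v s - m s \<omega>)))
          + (\<epsilon> / \<eta>) *\<^sub>R (proj_P *v (w t \<omega> - w 0 \<omega>)))"

end

theory Submission
  imports Defs
begin

text \<open>The noise is additive and acts on the first coordinate only, so no stochastic calculus is needed.
  Subtracting it from the error \<open>\<delta> = m - v\<close> leaves a process \<open>\<zeta> = \<delta> - \<sigma> \<beta> e\<^sub>1\<close> with
  \<open>\<sigma> = \<epsilon>/\<eta>\<close>, \<open>\<beta> = w\<^sub>1 - w\<^sub>1(0)\<close>, whose paths \<open>(p, q, z)\<close> are continuously differentiable.  Pathwise,
  \<open>|\<delta>|\<^sup>2 = |\<zeta>|\<^sup>2 + 2 \<sigma> \<beta> p + \<sigma>\<^sup>2 \<beta>\<^sup>2\<close>, and the fundamental theorem of calculus applies to the first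
  two summands (with \<open>\<beta>(T)\<close> held fixed), weighted by \<open>exp (\<lambda> s)\<close>.  After taking expectations,
  \<open>\<beta>(T)\<close> may be replaced by \<open>\<beta>(s)\<close> under the time integral, by independence of increments.  The
  resulting integrand is controlled by the dissipation inequality
  \<open>2 \<langle>\<delta>, \<zeta>'\<rangle> \<le> - \<lambda> |\<delta>|\<^sup>2\<close>, which comes from \<open>\<langle>B(\<delta>, \<delta>), \<delta>\<rangle> = 0\<close>, Young's inequality and
  \<open>|v|\<^sup>2 \<le> K\<close>.  Integrability is also pathwise: in \<open>\<langle>\<zeta>, \<zeta>'\<rangle>\<close> all cubic terms cancel, so \<open>|\<zeta>|\<^sup>2\<close> is
  bounded by its initial value plus a multiple of \<open>\<integral> \<beta>\<^sup>2\<close>.\<close>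

section \<open>The Lorenz attractor\<close>

lemma lorenz_rhs_nth:
  fixes u :: "real^3"
  shows "(- (lorenz_A \<alpha> b *v u) - lorenz_B u u + lorenz_f \<alpha> b r) $ 1 = - \<alpha> * u$1 + \<alpha> * u$2"
    "(- (lorenz_A \<alpha> b *v u) - lorenz_B u u + lorenz_f \<alpha> b r) $ 2 = - \<alpha> * u$1 - u$2 - u$1 * u$3"
    "(- (lorenz_A \<alpha> b *v u) - lorenz_B u u + lorenz_f \<alpha> b r) $ 3 = - b * u$3 + u$1 * u$2 - b * (r + \<alpha>)"
  by (simp_all add: lorenz_A_def lorenz_B_def lorenz_f_def matrix_vector_mult_def sum_3)

lemma proj_P_mult_nth:
  fixes u :: "real^3"
  shows "(proj_P *v u) $ 1 = u$1" "(proj_P *v u) $ 2 = 0" "(proj_P *v u) $ 3 = 0"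
  by (simp_all add: proj_P_def matrix_vector_mult_def sum_3)

lemma norm_vec3_squared: "(norm (u :: real^3))\<^sup>2 = (u$1)\<^sup>2 + (u$2)\<^sup>2 + (u$3)\<^sup>2"
  by (simp only: power2_norm_eq_inner inner_vec_def sum_3) (simp add: power2_eq_square)

lemma has_real_derivative_nth:
  assumes "(u has_vector_derivative u') F"
  shows "((\<lambda>t. u t $ i) has_real_derivative u' $ i) F"
  using bounded_linear.has_vector_derivative[OF bounded_linear_vec_nth assms]
  by (simp add: has_real_derivative_iff_has_vector_derivative)

text \<open>The \<alpha>-coupling of \<open>x\<close> and \<open>y\<close> and the cubic terms
  \<open>x * y * z\<close> cancel, leaving a diagonal form plus a linear term in \<open>z\<close>.
  One copy of the squared norm is split off; completing the square in \<open>z\<close> with the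
  remaining weight \<open>b - 1\<close> produces exactly the constant K.\<close>

lemma lorenz_energy_estimate:
  fixes \<alpha> b r x y z :: real
  assumes "\<alpha> > 1" "b > 1"
  shows "x * (- \<alpha> * x + \<alpha> * y) + y * (- \<alpha> * x - y - x * z) + z * (- b * z + x * y - b * (r + \<alpha>))
    \<le> b\<^sup>2 * (r + \<alpha>)\<^sup>2 / (4 * (b - 1)) - (x\<^sup>2 + y\<^sup>2 + z\<^sup>2)"
proof -
  have "b\<^sup>2 * (r + \<alpha>)\<^sup>2 / (4 * (b - 1)) + (b - 1) * z\<^sup>2 + b * (r + \<alpha>) * z
      = (2 * (b - 1) * z + b * (r + \<alpha>))\<^sup>2 / (4 * (b - 1))"
    using assms by (simp add: field_simps power2_eq_square)
  also have "\<dots> \<ge> 0"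
    using assms by simp
  finally have 1: "0 \<le> b\<^sup>2 * (r + \<alpha>)\<^sup>2 / (4 * (b - 1)) + (b - 1) * z\<^sup>2 + b * (r + \<alpha>) * z" .
  have "x\<^sup>2 \<le> \<alpha> * x\<^sup>2"
    using assms by (simp add: mult_le_cancel_right1)
  with 1 show ?thesis
    by (simp add: algebra_simps power2_eq_square)
qed

text \<open>Gronwall's argument: by the energy estimate the derivative of
  \<open>(norm (u s))^2 - K\<close> is at most \<open>- 2\<close> times itself, so this quantity
  weighted by \<open>exp (2 * s)\<close> decreases.\<close>

lemma lorenz_solution_norm_bound:
  assumes "\<alpha> > 1" "b > 1" and u: "lorenz_solution \<alpha> b r u" and "t \<ge> 0"
  defines "K \<equiv> b\<^sup>2 * (r + \<alpha>)\<^sup>2 / (4 * (b - 1))"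
  shows "(norm (u t))\<^sup>2 \<le> K + exp (- 2 * t) * (norm (u 0))\<^sup>2"
proof -
  have K: "K \<ge> 0"
    using assms by (simp add: K_def)
  define \<phi> where "\<phi> s = exp (2 * s) * ((u s $ 1)\<^sup>2 + (u s $ 2)\<^sup>2 + (u s $ 3)\<^sup>2 - K)" for s
  define R where "R s = - (lorenz_A \<alpha> b *v u s) - lorenz_B (u s) (u s) + lorenz_f \<alpha> b r" for s
  have du: "(u has_vector_derivative R s) (at s within {0..})" if "s \<ge> 0" for s
    using u that unfolding lorenz_solution_def R_def by auto
  note dR = du[THEN has_real_derivative_nth]
  define \<phi>' where "\<phi>' s = exp (2 * s) * (2 * (u s $ 1 * R s $ 1 + u s $ 2 * R s $ 2 + u s $ 3 * R s $ 3)
      + 2 * ((u s $ 1)\<^sup>2 + (u s $ 2)\<^sup>2 + (u s $ 3)\<^sup>2 - K))" for s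
  have d\<phi>: "(\<phi> has_real_derivative \<phi>' s) (at s within {0..})" if "s \<ge> 0" for s
    unfolding \<phi>_def \<phi>'_def
    by (rule derivative_eq_intros dR that refl | simp add: algebra_simps)+
  have "\<phi> t \<le> \<phi> 0"
  proof (rule DERIV_nonpos_imp_decreasing_open[OF \<open>t \<ge> 0\<close>])
    show "continuous_on {0..t} \<phi>"
      by (rule continuous_on_subset[of "{0..}"], rule DERIV_continuous_on, rule d\<phi>) auto
  next
    fix s assume s: "0 < s" "s < t"
    have "at s within {0..} = at s"
      by (rule at_within_interior) (use s in \<open>simp add: interior_real_atLeast\<close>)
    moreover have "\<phi>' s \<le> 0"
      using lorenz_energy_estimate[OF assms(1,2), of "u s $ 1" "u s $ 2" "u s $ 3" r]
      unfolding \<phi>'_def R_def lorenz_rhs_nth K_def[symmetric]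
      by (intro mult_nonneg_nonpos) (simp_all add: algebra_simps)
    ultimately show "\<exists>y. (\<phi> has_real_derivative y) (at s) \<and> y \<le> 0"
      using d\<phi>[of s] s by auto
  qed
  then have "exp (2 * t) * ((norm (u t))\<^sup>2 - K) \<le> (norm (u 0))\<^sup>2 - K"
    by (simp add: \<phi>_def norm_vec3_squared)
  then have "exp (- 2 * t) * (exp (2 * t) * ((norm (u t))\<^sup>2 - K)) \<le> exp (- 2 * t) * (norm (u 0))\<^sup>2"
    using K by (intro mult_left_mono) auto
  then show ?thesis
    by (simp add: mult.assoc[symmetric] exp_add[symmetric])
qed

text \<open>By invariance \<open>x\<close> can be reached at every time \<open>t\<close> from some
  point of the attractor. Those starting points are bounded by compactness, so their contribution
  decays like \<open>exp (- 2 * t)\<close> and only K survives in the limit.\<close>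

lemma lorenz_attractor_norm_bound:
  assumes "\<alpha> > 1" "b > 1" and \<A>: "lorenz_global_attractor \<alpha> b r \<A>" and "x \<in> \<A>"
  shows "(norm x)\<^sup>2 \<le> b\<^sup>2 * (r + \<alpha>)\<^sup>2 / (4 * (b - 1))"
proof -
  let ?K = "b\<^sup>2 * (r + \<alpha>)\<^sup>2 / (4 * (b - 1))"
  obtain B where B: "\<And>y. y \<in> \<A> \<Longrightarrow> norm y \<le> B"
    using \<A> compact_imp_bounded bounded_iff unfolding lorenz_global_attractor_def by metis
  have "((\<lambda>t. ?K + exp (- 2 * t) * B\<^sup>2) \<longlongrightarrow> ?K) at_top"
    by real_asymp
  moreover have "\<forall>\<^sub>F t in at_top. (norm x)\<^sup>2 \<le> ?K + exp (- 2 * t) * B\<^sup>2"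
    using eventually_ge_at_top[of "0::real"]
  proof eventually_elim
    case (elim t)
    with \<A> \<open>x \<in> \<A>\<close> obtain u where u: "lorenz_solution \<alpha> b r u" "u 0 \<in> \<A>" "x = u t"
      unfolding lorenz_global_attractor_def lorenz_flow_image_def by blast
    have "(norm (u 0))\<^sup>2 \<le> B\<^sup>2"
      using B[OF u(2)] by (intro power_mono) auto
    then have "exp (- 2 * t) * (norm (u 0))\<^sup>2 \<le> exp (- 2 * t) * B\<^sup>2"
      by (intro mult_left_mono) auto
    with lorenz_solution_norm_bound[OF assms(1,2) u(1) elim] show ?case
      unfolding u(3) by linarith
  qed
  ultimately show ?thesis
    by (rule tendsto_lowerbound) simp
qed

section \<open>Measurability and square integrability\<close>

text \<open>Gives joint measurability in time and outcome: a continuous path is the limit of its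
  values at times rounded down to finer and finer grids.\<close>

lemma measurable_continuous_process:
  fixes X :: "real \<Rightarrow> 'a \<Rightarrow> real"
  assumes X: "\<And>s. X s \<in> borel_measurable M"
    and cont: "\<And>\<omega>. \<omega> \<in> space M \<Longrightarrow> continuous_on UNIV (\<lambda>s. X s \<omega>)"
    and [measurable]: "f \<in> borel_measurable N" "g \<in> N \<rightarrow>\<^sub>M M"
  shows "(\<lambda>y. X (f y) (g y)) \<in> borel_measurable N"
proof (rule borel_measurable_LIMSEQ_metric)
  \<comment> \<open>The rounded time takes countably many values, so each approximant is glued from
    countably many measurable functions \<open>X c (g y)\<close>.\<close>
  define a where "a n y = real_of_int \<lfloor>real (Suc n) * f y\<rfloor> / real (Suc n)" for n y
  have [measurable]: "(\<lambda>y. X c (g y)) \<in> borel_measurable N" for c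
    using X by (rule measurable_compose[rotated]) measurable
  show "(\<lambda>y. X (a n y) (g y)) \<in> borel_measurable N" for n
    unfolding a_def
    by (rule measurable_compose_countable[where f = "\<lambda>i y. X (real_of_int i / real (Suc n)) (g y)"])
      measurable
  fix y assume "y \<in> space N"
  then have gy: "g y \<in> space M"
    by (rule measurable_space[rotated]) measurable
  have "(\<lambda>n. a n y) \<longlonglongrightarrow> f y"
  proof (rule tendsto_sandwich)
    have "f y - 1 / N \<le> real_of_int \<lfloor>N * f y\<rfloor> / N \<and> real_of_int \<lfloor>N * f y\<rfloor> / N \<le> f y" if "N > 0" for N
    proof -
      have "f y = N * f y / N" "f y - 1 / N = (N * f y - 1) / N"
        using that by (simp_all add: diff_divide_distrib)
      then show ?thesis
        using of_int_floor_le[of "N * f y"] real_of_int_floor_add_one_ge[of "N * f y"] that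
        by (metis (no_types, opaque_lifting) divide_right_mono less_eq_real_def diff_le_eq)
    qed
    then have "f y - 1 / real (Suc n) \<le> a n y \<and> a n y \<le> f y" for n
      unfolding a_def by simp
    then show "\<forall>\<^sub>F n in sequentially. f y - 1 / real (Suc n) \<le> a n y"
      "\<forall>\<^sub>F n in sequentially. a n y \<le> f y" by auto
  qed (real_asymp+)
  with cont[OF gy] show "(\<lambda>n. X (a n y) (g y)) \<longlonglongrightarrow> X (f y) (g y)"
    by (rule continuous_on_tendsto_compose) auto
qed

section \<open>Products of square-integrable functions and second moments\<close>

lemma integrable_mult_of_squares:
  fixes f g :: "'a \<Rightarrow> real"
  assumes [measurable]: "f \<in> borel_measurable M" "g \<in> borel_measurable M"
    and "integrable M (\<lambda>x. (f x)\<^sup>2)" "integrable M (\<lambda>x. (g x)\<^sup>2)"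
  shows "integrable M (\<lambda>x. f x * g x)"
proof (rule Bochner_Integration.integrable_bound)
  show "integrable M (\<lambda>x. (f x)\<^sup>2 + (g x)\<^sup>2)"
    using assms by simp
  show "AE x in M. norm (f x * g x) \<le> norm ((f x)\<^sup>2 + (g x)\<^sup>2)"
  proof (rule AE_I2)
    fix x
    have "0 \<le> (\<bar>f x\<bar> - \<bar>g x\<bar>)\<^sup>2" "0 \<le> \<bar>f x\<bar> * \<bar>g x\<bar>"
      by auto
    then have "\<bar>f x\<bar> * \<bar>g x\<bar> \<le> (f x)\<^sup>2 + (g x)\<^sup>2"
      unfolding power2_diff power2_abs by linarith
    then show "norm (f x * g x) \<le> norm ((f x)\<^sup>2 + (g x)\<^sup>2)"
      by (simp add: abs_mult)
  qed
qed measurable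

lemma (in prob_space) expectation_centered_indep_mult:
  fixes X Y :: "'a \<Rightarrow> real"
  assumes "integrable M X" "integrable M Y" "indep_var borel X borel Y" "expectation X = 0"
  shows "expectation (\<lambda>\<omega>. X \<omega> * Y \<omega>) = 0"
  using indep_var_lebesgue_integral[OF assms(3,1,2)] assms(4) by simp

lemma (in prob_space) normal_distributed_moments:
  assumes "0 < \<sigma>" and D: "distributed M lborel X (normal_density 0 \<sigma>)"
  shows "integrable M X" "expectation X = 0"
    "integrable M (\<lambda>\<omega>. (X \<omega>)\<^sup>2)" "expectation (\<lambda>\<omega>. (X \<omega>)\<^sup>2) = \<sigma>\<^sup>2"
proof -
  note [simp] = normal_distributed_expectation[OF assms]
  show "expectation X = 0" by simp
  show "integrable M X"
    using distributed_integrable[OF D, of "\<lambda>x. x"] integrable_normal_moment[OF assms(1), of 0 1] by simp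
  show "integrable M (\<lambda>\<omega>. (X \<omega>)\<^sup>2)"
    using distributed_integrable[OF D, of "\<lambda>x. x\<^sup>2"] integrable_normal_moment[OF assms(1), of 0 2] by simp
  show "expectation (\<lambda>\<omega>. (X \<omega>)\<^sup>2) = \<sigma>\<^sup>2"
    using normal_distributed_variance[OF assms] by simp
qed

text \<open>Membership in L2, used both over the probability space and over its product with a time
  interval. Measurability is included because it does not follow from integrability of the
  square.\<close>

definition square_integrable :: "'a measure \<Rightarrow> ('a \<Rightarrow> real) \<Rightarrow> bool" where
  "square_integrable M f \<longleftrightarrow> f \<in> borel_measurable M \<and> integrable M (\<lambda>x. (f x)\<^sup>2)"

lemma square_integrable_mult:
  assumes "square_integrable M f" "square_integrable M g"
  shows "integrable M (\<lambda>x. f x * g x)"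
  using assms unfolding square_integrable_def by (auto intro: integrable_mult_of_squares)

lemma square_integrable_add:
  assumes "square_integrable M f" "square_integrable M g"
  shows "square_integrable M (\<lambda>x. f x + g x)"
proof -
  have "integrable M (\<lambda>x. (f x)\<^sup>2 + (g x)\<^sup>2 + 2 * (f x * g x))"
    using assms square_integrable_mult[OF assms] by (auto simp: square_integrable_def)
  then show ?thesis
    using assms by (auto simp: square_integrable_def power2_sum mult.assoc)
qed

lemma square_integrable_bounded_mult:
  assumes [measurable]: "c \<in> borel_measurable M" and f: "square_integrable M f"
    and c: "\<And>x. x \<in> space M \<Longrightarrow> \<bar>c x\<bar> \<le> C"
  shows "square_integrable M (\<lambda>x. c x * f x)"
proof -
  have [measurable]: "f \<in> borel_measurable M"
    using f by (simp add: square_integrable_def)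
  have "integrable M (\<lambda>x. (c x * f x)\<^sup>2)"
  proof (rule Bochner_Integration.integrable_bound)
    show "integrable M (\<lambda>x. C\<^sup>2 * (f x)\<^sup>2)"
      using f by (simp add: square_integrable_def)
    show "AE x in M. norm ((c x * f x)\<^sup>2) \<le> norm (C\<^sup>2 * (f x)\<^sup>2)"
    proof (rule AE_I2)
      fix x assume "x \<in> space M"
      then have "\<bar>c x\<bar>\<^sup>2 \<le> C\<^sup>2"
        using c by (intro power_mono) auto
      then show "norm ((c x * f x)\<^sup>2) \<le> norm (C\<^sup>2 * (f x)\<^sup>2)"
        by (simp add: power_mult_distrib mult_right_mono)
    qed
  qed measurable
  then show ?thesis
    by (simp add: square_integrable_def)
qed

lemma square_integrable_cmult:
  "square_integrable M f \<Longrightarrow> square_integrable M (\<lambda>x. c * f x)"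
  by (rule square_integrable_bounded_mult[where C = "\<bar>c\<bar>"]) auto

section \<open>Lebesgue measure on a bounded time interval\<close>

abbreviation lborel_on :: "real \<Rightarrow> real measure" where
  "lborel_on T \<equiv> restrict_space lborel {0..T}"

lemma integrable_continuous_lborel_on:
  fixes f :: "real \<Rightarrow> real"
  assumes "continuous_on {0..T} f"
  shows "integrable (lborel_on T) f"
  using borel_integrable_atLeastAtMost'[OF assms]
  by (simp add: integrable_restrict_space set_integrable_def)

lemma integral_FTC_lborel_on:
  fixes F f :: "real \<Rightarrow> real" and T :: real
  assumes "0 \<le> T" and F: "\<And>s::real. 0 \<le> s \<Longrightarrow> (F has_real_derivative f s) (at s within {0..})"
    and "continuous_on {0..T} f"
  shows "integral\<^sup>L (lborel_on T) f = F T - F 0"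
proof -
  have "integral\<^sup>L (lborel_on T) f = integral\<^sup>L lborel (\<lambda>s::real. indicator {0..T} s *\<^sub>R f s)"
    by (subst integral_restrict_space) auto
  also have "\<dots> = F T - F 0"
  proof (rule integral_FTC_atLeastAtMost[OF \<open>0 \<le> T\<close> _ assms(3)])
    fix s :: real assume "0 \<le> s"
    then show "(F has_vector_derivative f s) (at s within {0..T})"
      by (intro has_vector_derivative_within_subset[of F "f s" s "{0..}" "{0..T}"]
          F[unfolded has_real_derivative_iff_has_vector_derivative]) auto
  qed
  finally show ?thesis .
qed

section \<open>Pathwise estimates of the error\<close>

text \<open>The bad term is the coupling \<open>x * c\<close> with
  \<open>c = vy * z - vz * q\<close>. Young's inequality pays for it with all of
  \<open>x^2 / \<eta>\<close> and with \<open>\<eta> / 4 * c^2\<close>; since \<open>c^2\<close> is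
  at most \<open>K * (q^2 + z^2)\<close>, the rate 1 drops to
  \<open>1 - \<eta> * K / 4\<close>.\<close>

lemma error_dissipation:
  fixes x q z vy vz \<alpha> b \<eta> K :: real
  assumes "\<alpha> > 1" "b > 1" "\<eta> > 0" and v: "vy\<^sup>2 + vz\<^sup>2 \<le> K"
  shows "- \<alpha> * x\<^sup>2 - x\<^sup>2 / \<eta> - q\<^sup>2 - b * z\<^sup>2 - vz * x * q + vy * x * z
    \<le> - (1 - \<eta> * K / 4) * (x\<^sup>2 + q\<^sup>2 + z\<^sup>2)"
proof -
  define c where "c = vy * z - vz * q"
  have "0 \<le> (2 * x - \<eta> * c)\<^sup>2 / (4 * \<eta>)"
    using assms by simp
  also have "\<dots> = x\<^sup>2 / \<eta> - x * c + \<eta> / 4 * c\<^sup>2"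
    using assms by (simp add: field_simps power2_eq_square)
  finally have 1: "x * c \<le> x\<^sup>2 / \<eta> + \<eta> / 4 * c\<^sup>2" by simp
  \<comment> \<open>Lagrange's identity, which yields Cauchy-Schwarz for \<open>c\<close> upon
    dropping the second square.\<close>
  have "c\<^sup>2 + (vy * q + vz * z)\<^sup>2 = (vy\<^sup>2 + vz\<^sup>2) * (q\<^sup>2 + z\<^sup>2)"
    unfolding c_def by algebra
  moreover have "(vy\<^sup>2 + vz\<^sup>2) * (q\<^sup>2 + z\<^sup>2) \<le> K * (q\<^sup>2 + z\<^sup>2)"
    using v by (intro mult_right_mono) auto
  moreover have "0 \<le> (vy * q + vz * z)\<^sup>2" by simp
  ultimately have "c\<^sup>2 \<le> K * (q\<^sup>2 + z\<^sup>2)" by linarith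
  then have 2: "\<eta> / 4 * c\<^sup>2 \<le> \<eta> / 4 * (K * (q\<^sup>2 + z\<^sup>2))"
    using assms by (intro mult_left_mono) auto
  have "0 \<le> vy\<^sup>2 + vz\<^sup>2" by simp
  then have "0 \<le> K" using v by linarith
  then have "0 \<le> \<eta> * K / 4 * x\<^sup>2"
    using assms by simp
  moreover have "x\<^sup>2 \<le> \<alpha> * x\<^sup>2" "z\<^sup>2 \<le> b * z\<^sup>2"
    using assms by (simp_all add: mult_le_cancel_right1)
  ultimately show ?thesis
    using 1 2 by (simp add: algebra_simps c_def)
qed

lemma young_square:
  fixes a p y l :: real
  assumes "l > 0"
  shows "2 * (y * (a * p)) \<le> l * p\<^sup>2 + y\<^sup>2 * a\<^sup>2 / l"
proof -
  have "0 \<le> (l * p - y * a)\<^sup>2 / l"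
    using assms by simp
  also have "\<dots> = l * p\<^sup>2 + y\<^sup>2 * a\<^sup>2 / l - 2 * (y * (a * p))"
    using assms by (simp add: field_simps power2_eq_square)
  finally show ?thesis by simp
qed

text \<open>Here \<open>y\<close> stands for the noise shift \<sigma> \<beta>. The terms free of
  \<open>y\<close> are those of \<open>error_dissipation\<close> and supply \<open>lam\<close> times
  each of the squares of \<open>p\<close>, \<open>q\<close>, \<open>z\<close>. Each of the three
  terms linear in \<open>y\<close> is absorbed into one of these by Young's inequality with weight
  \<open>lam\<close>, at the cost of a multiple of \<open>y^2\<close>.\<close>

lemma error_growth:
  fixes p q z y vy vz \<alpha> b \<eta> K lam :: real
  assumes par: "\<alpha> > 1" "b > 1" "\<eta> > 0" "\<eta> * K < 4" and lam: "lam = 2 * (1 - \<eta> * K / 4)"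
    and v: "vy\<^sup>2 + vz\<^sup>2 \<le> K"
  shows "2 * (p * (- \<alpha> * (p + y) + \<alpha> * q - (p + y) / \<eta>) - \<alpha> * (p + y) * q - q\<^sup>2 - b * z\<^sup>2
      - vz * (p + y) * q + vy * (p + y) * z) \<le> y\<^sup>2 * ((\<alpha> + 1 / \<eta>)\<^sup>2 + 2 * \<alpha>\<^sup>2 + 2 * K) / lam"
proof -
  have l: "lam > 0" using par lam by (simp add: mult.commute)
  have "2 * (- \<alpha> * p\<^sup>2 - p\<^sup>2 / \<eta> - q\<^sup>2 - b * z\<^sup>2 - vz * p * q + vy * p * z) \<le> - (lam * (p\<^sup>2 + q\<^sup>2 + z\<^sup>2))"
    using error_dissipation[OF par(1-3) v, of p q z] unfolding lam by (simp add: algebra_simps)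
  moreover have "2 * (y * (- (\<alpha> + 1 / \<eta>) * p)) \<le> lam * p\<^sup>2 + y\<^sup>2 * (\<alpha> + 1 / \<eta>)\<^sup>2 / lam"
    using young_square[OF l, of "- y" "\<alpha> + 1 / \<eta>" p]
    by (simp add: algebra_simps)
  moreover note young_square[OF l, of y "- (\<alpha> + vz)" q] young_square[OF l, of y vy z]
  moreover have "y\<^sup>2 * (\<alpha> + 1 / \<eta>)\<^sup>2 / lam + y\<^sup>2 * (- (\<alpha> + vz))\<^sup>2 / lam + y\<^sup>2 * vy\<^sup>2 / lam
    \<le> y\<^sup>2 * ((\<alpha> + 1 / \<eta>)\<^sup>2 + 2 * \<alpha>\<^sup>2 + 2 * K) / lam"
  proof -
    \<comment> \<open>Adding \<open>(\<alpha> - vz)^2\<close> bounds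
      \<open>(\<alpha> + vz)^2\<close> by \<open>2 * \<alpha>^2 + 2 * vz^2\<close>; together with
      \<open>vy^2\<close> this costs at most \<open>2 * \<alpha>^2 + 2 * K\<close>.\<close>
    have "0 \<le> (\<alpha> - vz)\<^sup>2" "0 \<le> vy\<^sup>2" by auto
    then have "(\<alpha> + 1 / \<eta>)\<^sup>2 + (- (\<alpha> + vz))\<^sup>2 + vy\<^sup>2 \<le> (\<alpha> + 1 / \<eta>)\<^sup>2 + 2 * \<alpha>\<^sup>2 + 2 * K"
      using v unfolding power2_minus power2_sum[of \<alpha> vz] power2_diff by linarith
    then have "y\<^sup>2 * ((\<alpha> + 1 / \<eta>)\<^sup>2 + (- (\<alpha> + vz))\<^sup>2 + vy\<^sup>2) / lam
      \<le> y\<^sup>2 * ((\<alpha> + 1 / \<eta>)\<^sup>2 + 2 * \<alpha>\<^sup>2 + 2 * K) / lam"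
      using l by (intro divide_right_mono mult_left_mono) auto
    then show ?thesis by (simp add: distrib_left add_divide_distrib)
  qed
  moreover have "2 * (p * (- \<alpha> * (p + y) + \<alpha> * q - (p + y) / \<eta>) - \<alpha> * (p + y) * q - q\<^sup>2 - b * z\<^sup>2
      - vz * (p + y) * q + vy * (p + y) * z)
    = 2 * (- \<alpha> * p\<^sup>2 - p\<^sup>2 / \<eta> - q\<^sup>2 - b * z\<^sup>2 - vz * p * q + vy * p * z)
      + 2 * (y * (- (\<alpha> + 1 / \<eta>) * p)) + 2 * (y * (- (\<alpha> + vz) * q)) + 2 * (y * (vy * z))"
    by (simp add: algebra_simps add_divide_distrib power2_eq_square)
  ultimately show ?thesis
    unfolding distrib_left[of lam] by linarith
qed

text \<open>The error equations with \<open>p\<close>, \<open>q\<close>, \<open>z\<close> the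
  coordinates of \<zeta>, so that \<open>p + \<sigma> * \<beta>\<close> is the first coordinate of
  \<delta>. Paths are continuous at all real times and for every outcome, which makes joint
  measurability available without exceptional sets. The probabilistic input is reduced to two
  moments of \<beta> and the orthogonality of increments to linear combinations of \<open>p\<close>,
  \<open>q\<close>, \<beta>, the form taken by \<open>lam * p + dp\<close>. Integrability is a
  premise there because it is derived only later from these assumptions.\<close>

locale lorenz_error = prob_space M for M :: "'a measure" +
  fixes \<alpha> b \<eta> \<sigma> K lam :: real
    and vx vy vz :: "real \<Rightarrow> real"
    and \<beta> p q z :: "real \<Rightarrow> 'a \<Rightarrow> real"
    and p0 q0 z0 :: real
  assumes params: "\<alpha> > 1" "b > 1" "\<eta> > 0" "\<eta> * K < 4" and lam: "lam = 2 * (1 - \<eta> * K / 4)"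
    and v_cont: "continuous_on UNIV vx" "continuous_on UNIV vy" "continuous_on UNIV vz"
    and v_bound: "\<And>s. (vy s)\<^sup>2 + (vz s)\<^sup>2 \<le> K"
    and meas: "\<And>s. \<beta> s \<in> borel_measurable M" "\<And>s. p s \<in> borel_measurable M"
      "\<And>s. q s \<in> borel_measurable M" "\<And>s. z s \<in> borel_measurable M"
    and cont: "\<And>\<omega>. \<omega> \<in> space M \<Longrightarrow> continuous_on UNIV (\<lambda>s. \<beta> s \<omega>)"
      "\<And>\<omega>. \<omega> \<in> space M \<Longrightarrow> continuous_on UNIV (\<lambda>s. p s \<omega>)"
      "\<And>\<omega>. \<omega> \<in> space M \<Longrightarrow> continuous_on UNIV (\<lambda>s. q s \<omega>)"
      "\<And>\<omega>. \<omega> \<in> space M \<Longrightarrow> continuous_on UNIV (\<lambda>s. z s \<omega>)"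
    and deriv_p: "\<And>\<omega> s. \<omega> \<in> space M \<Longrightarrow> 0 \<le> s \<Longrightarrow> ((\<lambda>s. p s \<omega>) has_real_derivative
        (- \<alpha> * (p s \<omega> + \<sigma> * \<beta> s \<omega>) + \<alpha> * q s \<omega> - (p s \<omega> + \<sigma> * \<beta> s \<omega>) / \<eta>)) (at s within {0..})"
    and deriv_q: "\<And>\<omega> s. \<omega> \<in> space M \<Longrightarrow> 0 \<le> s \<Longrightarrow> ((\<lambda>s. q s \<omega>) has_real_derivative
        (- \<alpha> * (p s \<omega> + \<sigma> * \<beta> s \<omega>) - q s \<omega> - ((p s \<omega> + \<sigma> * \<beta> s \<omega>) * z s \<omega> + vx s * z s \<omega>
          + vz s * (p s \<omega> + \<sigma> * \<beta> s \<omega>)))) (at s within {0..})"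
    and deriv_z: "\<And>\<omega> s. \<omega> \<in> space M \<Longrightarrow> 0 \<le> s \<Longrightarrow> ((\<lambda>s. z s \<omega>) has_real_derivative
        (- b * z s \<omega> + ((p s \<omega> + \<sigma> * \<beta> s \<omega>) * q s \<omega> + vx s * q s \<omega>
          + vy s * (p s \<omega> + \<sigma> * \<beta> s \<omega>)))) (at s within {0..})"
    and init: "AE \<omega> in M. p 0 \<omega> = p0" "AE \<omega> in M. q 0 \<omega> = q0" "AE \<omega> in M. z 0 \<omega> = z0"
    and expectation_\<beta>: "\<And>s. 0 \<le> s \<Longrightarrow> expectation (\<beta> s) = 0"
    and integrable_\<beta>_squared: "\<And>s. 0 \<le> s \<Longrightarrow> integrable M (\<lambda>\<omega>. (\<beta> s \<omega>)\<^sup>2)"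
    and expectation_\<beta>_squared: "\<And>s. 0 \<le> s \<Longrightarrow> expectation (\<lambda>\<omega>. (\<beta> s \<omega>)\<^sup>2) = s"
    and orthogonal_increment: "\<And>s t c d e. 0 \<le> s \<Longrightarrow> s \<le> t \<Longrightarrow>
        integrable M (\<lambda>\<omega>. c * p s \<omega> + d * q s \<omega> + e * \<beta> s \<omega>) \<Longrightarrow>
        expectation (\<lambda>\<omega>. (\<beta> t \<omega> - \<beta> s \<omega>) * (c * p s \<omega> + d * q s \<omega> + e * \<beta> s \<omega>)) = 0"
begin

text \<open>The first coordinate of the full error \<delta>. The next three functions are the time
  derivatives of the coordinates of \<zeta>.\<close>

definition x where "x s \<omega> = p s \<omega> + \<sigma> * \<beta> s \<omega>"
definition dp where "dp s \<omega> = - \<alpha> * x s \<omega> + \<alpha> * q s \<omega> - x s \<omega> / \<eta>"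
definition dq where "dq s \<omega> = - \<alpha> * x s \<omega> - q s \<omega> - (x s \<omega> * z s \<omega> + vx s * z s \<omega> + vz s * x s \<omega>)"
definition dz where "dz s \<omega> = - b * z s \<omega> + (x s \<omega> * q s \<omega> + vx s * q s \<omega> + vy s * x s \<omega>)"

text \<open>The constant from \<open>error_growth\<close>, with \<sigma> squared taken out of
  \<open>y = \<sigma> * \<beta>\<close>.\<close>

definition growth where "growth = \<sigma>\<^sup>2 * ((\<alpha> + 1 / \<eta>)\<^sup>2 + 2 * \<alpha>\<^sup>2 + 2 * K) / lam"

definition sqnorm where "sqnorm s \<omega> = (p s \<omega>)\<^sup>2 + (q s \<omega>)\<^sup>2 + (z s \<omega>)\<^sup>2"

text \<open>The time derivative of \<open>sqnorm\<close> along a path.\<close>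

definition drift where "drift s \<omega> = 2 * (p s \<omega> * dp s \<omega> + q s \<omega> * dq s \<omega> + z s \<omega> * dz s \<omega>)"

lemma lam_pos: "lam > 0"
  using params lam by (simp add: mult.commute)

lemma derivs:
  assumes "\<omega> \<in> space M" "0 \<le> s"
  shows "((\<lambda>s. p s \<omega>) has_real_derivative dp s \<omega>) (at s within {0..})"
    "((\<lambda>s. q s \<omega>) has_real_derivative dq s \<omega>) (at s within {0..})"
    "((\<lambda>s. z s \<omega>) has_real_derivative dz s \<omega>) (at s within {0..})"
  using deriv_p[OF assms] deriv_q[OF assms] deriv_z[OF assms]
  unfolding dp_def dq_def dz_def x_def by blast+

lemma conts:
  assumes "\<omega> \<in> space M"
  shows "continuous_on A (\<lambda>s. \<beta> s \<omega>)" "continuous_on A (\<lambda>s. p s \<omega>)"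
    "continuous_on A (\<lambda>s. q s \<omega>)" "continuous_on A (\<lambda>s. z s \<omega>)"
    "continuous_on A vx" "continuous_on A vy" "continuous_on A vz"
  using cont[OF assms] v_cont by (auto elim: continuous_on_subset)

lemma continuous_derivs:
  assumes "\<omega> \<in> space M"
  shows "continuous_on A (\<lambda>s. dp s \<omega>)" "continuous_on A (\<lambda>s. dq s \<omega>)" "continuous_on A (\<lambda>s. dz s \<omega>)"
  unfolding dp_def dq_def dz_def x_def by (intro continuous_intros conts[OF assms]; use params in simp)+

text \<open>The products of \<open>q\<close> and \<open>z\<close> with \<open>x\<close> or
  \<open>vx\<close> cancel between \<open>q * dq\<close> and \<open>z * dz\<close>. Thus the drift
  is quadratic in the processes, and square integrability will suffice to integrate it.\<close>

lemma drift_eq: "drift s \<omega> = 2 * (p s \<omega> * dp s \<omega> + q s \<omega> * (- \<alpha> * x s \<omega> - q s \<omega> - vz s * x s \<omega>)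
    + z s \<omega> * (- b * z s \<omega> + vy s * x s \<omega>))"
  unfolding drift_def dq_def dz_def by (simp add: algebra_simps)

lemma drift_le_growth: "drift s \<omega> \<le> growth * (\<beta> s \<omega>)\<^sup>2"
  using error_growth[OF params lam v_bound[of s], of "p s \<omega>" "\<sigma> * \<beta> s \<omega>" "q s \<omega>" "z s \<omega>"]
  unfolding drift_eq growth_def dp_def x_def
  by (simp add: power_mult_distrib algebra_simps power2_eq_square)

text \<open>With \<delta> = \<zeta> + \<sigma> \<beta> e1, the bracket is |\<delta>|^2 and the other
  two terms together are twice the inner product of \<delta> with the derivative of \<zeta>. This is
  a quadratic form in \<open>x\<close>, \<open>q\<close>, \<open>z\<close>, so
  \<open>error_dissipation\<close> applies to it.\<close>

lemma dissipation:
  "lam * (sqnorm s \<omega> + 2 * \<sigma> * \<beta> s \<omega> * p s \<omega> + \<sigma>\<^sup>2 * (\<beta> s \<omega>)\<^sup>2) + drift s \<omega> + 2 * \<sigma> * \<beta> s \<omega> * dp s \<omega> \<le> 0"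
proof -
  have "drift s \<omega> + 2 * \<sigma> * \<beta> s \<omega> * dp s \<omega> = 2 * (- \<alpha> * (x s \<omega>)\<^sup>2 - (x s \<omega>)\<^sup>2 / \<eta> - (q s \<omega>)\<^sup>2 - b * (z s \<omega>)\<^sup>2
      - vz s * x s \<omega> * q s \<omega> + vy s * x s \<omega> * z s \<omega>)"
    unfolding drift_eq dp_def x_def by (simp add: algebra_simps power2_eq_square add_divide_distrib)
  also have "\<dots> \<le> - lam * ((x s \<omega>)\<^sup>2 + (q s \<omega>)\<^sup>2 + (z s \<omega>)\<^sup>2)"
    using error_dissipation[OF params(1-3) v_bound[of s], of "x s \<omega>" "q s \<omega>" "z s \<omega>"]
    unfolding lam by (simp add: algebra_simps)
  also have "(x s \<omega>)\<^sup>2 + (q s \<omega>)\<^sup>2 + (z s \<omega>)\<^sup>2 = sqnorm s \<omega> + 2 * \<sigma> * \<beta> s \<omega> * p s \<omega> + \<sigma>\<^sup>2 * (\<beta> s \<omega>)\<^sup>2"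
    unfolding x_def sqnorm_def by (simp add: power2_sum power_mult_distrib)
  finally show ?thesis by simp
qed

text \<open>Integrates \<open>drift_le_growth\<close> along the path. The right-hand side is free of
  \<open>t\<close>, so that one random variable controls the whole path up to
  \<open>T\<close>.\<close>

lemma sqnorm_bound:
  assumes \<omega>: "\<omega> \<in> space M" and "0 \<le> t" "t \<le> T"
  shows "sqnorm t \<omega> \<le> sqnorm 0 \<omega> + growth * (\<integral>s. (\<beta> s \<omega>)\<^sup>2 \<partial>lborel_on T)"
proof -
  have g: "growth \<ge> 0"
  proof -
    have "0 \<le> (vy 0)\<^sup>2 + (vz 0)\<^sup>2" by simp
    then have "K \<ge> 0" using v_bound[of 0] by linarith
    then show ?thesis unfolding growth_def using lam_pos by simp
  qed
  have ct: "continuous_on A (\<lambda>s. drift s \<omega>)" for A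
    unfolding drift_def by (intro continuous_intros conts[OF \<omega>] continuous_derivs[OF \<omega>])
  have cb: "continuous_on A (\<lambda>s. growth * (\<beta> s \<omega>)\<^sup>2)" for A
    by (intro continuous_intros conts[OF \<omega>])
  have "sqnorm t \<omega> - sqnorm 0 \<omega> = (\<integral>s. drift s \<omega> \<partial>lborel_on t)"
  proof (rule integral_FTC_lborel_on[symmetric, OF \<open>0 \<le> t\<close> _ ct])
    fix s :: real assume "0 \<le> s"
    show "((\<lambda>s. sqnorm s \<omega>) has_real_derivative drift s \<omega>) (at s within {0..})"
      unfolding sqnorm_def drift_def
      by (rule derivative_eq_intros derivs[OF \<omega> \<open>0 \<le> s\<close>] refl | simp add: algebra_simps)+
  qed
  also have "\<dots> \<le> (\<integral>s. growth * (\<beta> s \<omega>)\<^sup>2 \<partial>lborel_on t)"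
    by (intro integral_mono integrable_continuous_lborel_on ct cb drift_le_growth)
  also have "\<dots> = (\<integral>s. indicator {0..t} s *\<^sub>R (growth * (\<beta> s \<omega>)\<^sup>2) \<partial>lborel)"
    by (subst integral_restrict_space) auto
  \<comment> \<open>Lengthening the interval from \<open>t\<close> to \<open>T\<close> needs
    \<open>growth\<close> to be nonnegative.\<close>
  also have "\<dots> \<le> (\<integral>s. indicator {0..T} s *\<^sub>R (growth * (\<beta> s \<omega>)\<^sup>2) \<partial>lborel)"
    using borel_integrable_atLeastAtMost'[OF cb] g \<open>t \<le> T\<close>
    by (intro integral_mono) (auto simp: set_integrable_def split: split_indicator)
  also have "\<dots> = (\<integral>s. growth * (\<beta> s \<omega>)\<^sup>2 \<partial>lborel_on T)"
    by (subst integral_restrict_space) auto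
  also have "\<dots> = growth * (\<integral>s. (\<beta> s \<omega>)\<^sup>2 \<partial>lborel_on T)"
    by simp
  finally show ?thesis by simp
qed

section \<open>Integrability over time and probability space\<close>

abbreviation paths :: "real \<Rightarrow> (real \<times> 'a) measure" where
  "paths T \<equiv> lborel_on T \<Otimes>\<^sub>M M"

lemma finite_measure_lborel_on: "finite_measure (lborel_on T)"
  by (rule finite_measureI) (simp add: emeasure_restrict_space space_restrict_space emeasure_lborel_Icc_eq)

lemma pair_sigma_finite_paths: "pair_sigma_finite (lborel_on T) M"
  using finite_measure.axioms(1)[OF finite_measure_lborel_on] sigma_finite_measure_axioms
  by (rule pair_sigma_finite.intro)

lemma measurable_time: "fst \<in> borel_measurable (paths T)"
  by (rule measurable_compose[OF measurable_fst measurable_restrict_space1]) simp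

lemma measurable_paths:
  "(\<lambda>y. \<beta> (fst y) (snd y)) \<in> borel_measurable (paths T)"
  "(\<lambda>y. p (fst y) (snd y)) \<in> borel_measurable (paths T)"
  "(\<lambda>y. q (fst y) (snd y)) \<in> borel_measurable (paths T)"
  "(\<lambda>y. z (fst y) (snd y)) \<in> borel_measurable (paths T)"
  by (rule measurable_continuous_process[OF meas(1) cont(1) measurable_time measurable_snd]
      measurable_continuous_process[OF meas(2) cont(2) measurable_time measurable_snd]
      measurable_continuous_process[OF meas(3) cont(3) measurable_time measurable_snd]
      measurable_continuous_process[OF meas(4) cont(4) measurable_time measurable_snd]; assumption)+

lemma time_nonneg: "y \<in> space (paths T) \<Longrightarrow> 0 \<le> fst y \<and> fst y \<le> T \<and> snd y \<in> space M"
  by (auto simp: space_pair_measure space_restrict_space)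

lemma integrable_paths_snd:
  fixes f :: "'a \<Rightarrow> real"
  assumes f: "integrable M f"
  shows "integrable (paths T) (\<lambda>y. f (snd y))"
proof -
  interpret L: finite_measure "lborel_on T" by (rule finite_measure_lborel_on)
  interpret pair_sigma_finite "lborel_on T" M by (rule pair_sigma_finite_paths)
  have [measurable]: "f \<in> borel_measurable M" using f by auto
  show ?thesis
    by (rule Fubini_integrable) (use f in auto)
qed

text \<open>By Fubini it is enough that the second moment of \<open>\<beta> s\<close>, which equals
  \<open>s\<close>, is integrable over the time interval.\<close>

lemma square_integrable_paths_\<beta>: "square_integrable (paths T) (\<lambda>y. \<beta> (fst y) (snd y))"
proof -
  interpret pair_sigma_finite "lborel_on T" M by (rule pair_sigma_finite_paths)
  note [measurable] = measurable_paths(1)[of T]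
  have "integrable (paths T) (\<lambda>y. (\<beta> (fst y) (snd y))\<^sup>2)"
  proof (rule Fubini_integrable)
    have "integrable (lborel_on T) (\<lambda>s. s)"
      by (intro integrable_continuous_lborel_on continuous_intros)
    also have "integrable (lborel_on T) (\<lambda>s. s) \<longleftrightarrow>
      integrable (lborel_on T) (\<lambda>s. \<integral>\<omega>. norm ((\<beta> (fst (s, \<omega>)) (snd (s, \<omega>)))\<^sup>2) \<partial>M)"
      by (rule Bochner_Integration.integrable_cong)
        (auto simp: space_restrict_space expectation_\<beta>_squared)
    finally show "integrable (lborel_on T) (\<lambda>s. \<integral>\<omega>. norm ((\<beta> (fst (s, \<omega>)) (snd (s, \<omega>)))\<^sup>2) \<partial>M)" .
    show "AE s in lborel_on T. integrable M (\<lambda>\<omega>. (\<beta> (fst (s, \<omega>)) (snd (s, \<omega>)))\<^sup>2)"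
      by (rule AE_I2) (auto simp: space_restrict_space integrable_\<beta>_squared)
  qed measurable
  then show ?thesis
    using measurable_paths(1)[of T] by (simp add: square_integrable_def)
qed

text \<open>An integrable majorant of the squares of \<open>p\<close>, \<open>q\<close>,
  \<open>z\<close>, uniform over times in \<open>[0, T]\<close>; it yields square integrability at
  fixed times and over the product space alike.\<close>

definition dominant where
  "dominant T \<omega> = sqnorm 0 \<omega> + growth * (\<integral>s. (\<beta> s \<omega>)\<^sup>2 \<partial>lborel_on T)"

lemma sqnorm_init: "AE \<omega> in M. sqnorm 0 \<omega> = p0\<^sup>2 + q0\<^sup>2 + z0\<^sup>2"
  using init by eventually_elim (simp add: sqnorm_def)

lemma measurable_sqnorm: "sqnorm s \<in> borel_measurable M"
  using meas unfolding sqnorm_def[abs_def] by measurable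

lemma integrable_sqnorm_init: "integrable M (sqnorm 0)"
  using integrable_cong_AE[THEN iffD2, OF measurable_sqnorm _ sqnorm_init] by simp

lemma integrable_dominant: "integrable M (dominant T)"
proof -
  interpret pair_sigma_finite "lborel_on T" M by (rule pair_sigma_finite_paths)
  have "integrable (paths T) (\<lambda>(s, \<omega>). (\<beta> s \<omega>)\<^sup>2)"
    using square_integrable_paths_\<beta>[of T] by (simp add: square_integrable_def split_beta')
  then have "integrable M (\<lambda>\<omega>. \<integral>s. (\<beta> s \<omega>)\<^sup>2 \<partial>lborel_on T)"
    by (rule integrable_snd)
  then show ?thesis
    unfolding dominant_def[abs_def] using integrable_sqnorm_init by simp
qed

lemma squares_le_dominant:
  assumes "\<omega> \<in> space M" "0 \<le> t" "t \<le> T"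
  shows "(p t \<omega>)\<^sup>2 \<le> dominant T \<omega>" "(q t \<omega>)\<^sup>2 \<le> dominant T \<omega>" "(z t \<omega>)\<^sup>2 \<le> dominant T \<omega>"
proof -
  have "0 \<le> (p t \<omega>)\<^sup>2" "0 \<le> (q t \<omega>)\<^sup>2" "0 \<le> (z t \<omega>)\<^sup>2" by simp_all
  then show "(p t \<omega>)\<^sup>2 \<le> dominant T \<omega>" "(q t \<omega>)\<^sup>2 \<le> dominant T \<omega>" "(z t \<omega>)\<^sup>2 \<le> dominant T \<omega>"
    using sqnorm_bound[OF assms] unfolding dominant_def sqnorm_def[of t] by linarith+
qed

lemma square_integrable_of_le_dominant:
  assumes "X \<in> borel_measurable M" "\<And>\<omega>. \<omega> \<in> space M \<Longrightarrow> (X \<omega>)\<^sup>2 \<le> dominant T \<omega>"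
  shows "square_integrable M X"
proof -
  have "integrable M (\<lambda>\<omega>. (X \<omega>)\<^sup>2)"
    by (rule Bochner_Integration.integrable_bound[OF integrable_dominant[of T]])
      (use assms in \<open>auto intro!: AE_I2 order_trans[OF _ abs_ge_self]\<close>)
  then show ?thesis using assms by (simp add: square_integrable_def)
qed

lemma square_integrable_paths_of_le_dominant:
  assumes "X \<in> borel_measurable (paths T)" "\<And>y. y \<in> space (paths T) \<Longrightarrow> (X y)\<^sup>2 \<le> dominant T (snd y)"
  shows "square_integrable (paths T) X"
proof -
  have "integrable (paths T) (\<lambda>y. (X y)\<^sup>2)"
    by (rule Bochner_Integration.integrable_bound[OF integrable_paths_snd[OF integrable_dominant[of T]]])
      (use assms in \<open>auto intro!: AE_I2 order_trans[OF _ abs_ge_self]\<close>)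
  then show ?thesis using assms by (simp add: square_integrable_def)
qed

lemma square_integrable_coords:
  assumes "0 \<le> s"
  shows "square_integrable M (\<beta> s)" "square_integrable M (p s)" "square_integrable M (q s)"
    "square_integrable M (z s)"
proof -
  show "square_integrable M (\<beta> s)"
    using assms meas integrable_\<beta>_squared by (simp add: square_integrable_def)
  show "square_integrable M (p s)" "square_integrable M (q s)" "square_integrable M (z s)"
    by (rule square_integrable_of_le_dominant[of _ s]; use assms meas squares_le_dominant in blast)+
qed

lemma square_integrable_paths:
  "square_integrable (paths T) (\<lambda>y. p (fst y) (snd y))"
  "square_integrable (paths T) (\<lambda>y. q (fst y) (snd y))"
  "square_integrable (paths T) (\<lambda>y. z (fst y) (snd y))"
  using measurable_paths[of T] time_nonneg[of _ T]
  by (auto intro!: square_integrable_paths_of_le_dominant squares_le_dominant)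

lemma square_integrable_paths_final:
  assumes "0 \<le> T"
  shows "square_integrable (paths T) (\<lambda>y. \<beta> T (snd y))"
  using integrable_paths_snd[OF integrable_\<beta>_squared[OF assms], of T]
    measurable_compose[OF measurable_snd[of "lborel_on T" M] meas(1)]
  by (simp add: square_integrable_def)

section \<open>The mean square error\<close>

text \<open>The derivative in \<open>s\<close> of \<open>exp (lam * s) * (sqnorm s \<omega> + 2 *
  \<sigma> * \<beta> T \<omega> * p s \<omega>)\<close>. The noise is frozen at its final value
  because Brownian paths cannot be differentiated; at \<open>s = T\<close> the bracket equals
  |\<delta>|^2 up to the term \<sigma>^2 \<beta>^2.\<close>

definition integrand where
  "integrand T s \<omega> = exp (lam * s) * (lam * sqnorm s \<omega> + drift s \<omega>
      + 2 * \<sigma> * \<beta> T \<omega> * (lam * p s \<omega> + dp s \<omega>))"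

text \<open>Every summand is a product of two square-integrable factors, which is possible since
  \<open>drift_eq\<close> contains no cubic terms. Forms such as \<open>- 1 * q s \<omega>\<close>
  match the closure rules for scalar and time-dependent weights.\<close>

lemma integrand_as_products:
  "integrand T s \<omega> =
     (exp (lam * s) * p s \<omega>) * (lam * p s \<omega> + 2 * dp s \<omega>)
   + (exp (lam * s) * q s \<omega>) * (lam * q s \<omega> + 2 * (- \<alpha> * x s \<omega> + - 1 * q s \<omega> + - vz s * x s \<omega>))
   + (exp (lam * s) * z s \<omega>) * (lam * z s \<omega> + 2 * (- b * z s \<omega> + vy s * x s \<omega>))
   + (2 * \<sigma> * \<beta> T \<omega>) * (exp (lam * s) * (lam * p s \<omega> + dp s \<omega>))"
  unfolding integrand_def drift_eq sqnorm_def
  by (simp add: algebra_simps power2_eq_square)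

lemma dp_linear: "dp s \<omega> = (- \<alpha> - 1 / \<eta>) * x s \<omega> + \<alpha> * q s \<omega>"
  unfolding dp_def by (simp add: algebra_simps)

lemma square_integrable_linear:
  assumes "0 \<le> s"
  shows "square_integrable M (x s)" "square_integrable M (dp s)"
  unfolding x_def[abs_def] dp_linear[abs_def]
  by (intro square_integrable_add square_integrable_cmult square_integrable_coords assms)+

lemma integrable_integrand:
  assumes "0 \<le> s" "0 \<le> T"
  shows "integrable M (integrand T s)"
  unfolding integrand_as_products[abs_def]
  by (intro Bochner_Integration.integrable_add square_integrable_mult square_integrable_add
      square_integrable_cmult square_integrable_coords square_integrable_linear assms)

lemma square_integrable_paths_weight:
  assumes c: "continuous_on UNIV c" and f: "square_integrable (paths T) f"
  shows "square_integrable (paths T) (\<lambda>y. c (fst y) * f y)"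
proof -
  have "compact (c ` {0..T})"
    by (intro compact_continuous_image continuous_on_subset[OF c]) auto
  then obtain C where C: "\<And>s. s \<in> {0..T} \<Longrightarrow> \<bar>c s\<bar> \<le> C"
    by (metis compact_imp_bounded bounded_iff imageI real_norm_def)
  have "c \<in> borel_measurable borel"
    using c by (rule borel_measurable_continuous_onI)
  then have "(\<lambda>y. c (fst y)) \<in> borel_measurable (paths T)"
    by (rule measurable_compose[OF measurable_time])
  then show ?thesis
    using f by (rule square_integrable_bounded_mult[where C = C]) (use time_nonneg C in auto)
qed

lemma square_integrable_paths_linear:
  "square_integrable (paths T) (\<lambda>y. x (fst y) (snd y))"
  "square_integrable (paths T) (\<lambda>y. dp (fst y) (snd y))"
  unfolding x_def dp_linear
  by (intro square_integrable_add square_integrable_cmult square_integrable_paths_\<beta>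
      square_integrable_paths)+

lemma integrable_paths_integrand:
  assumes "0 \<le> T"
  shows "integrable (paths T) (\<lambda>(s, \<omega>). integrand T s \<omega>)"
  unfolding integrand_as_products split_beta'
  by (intro Bochner_Integration.integrable_add square_integrable_mult square_integrable_add
      square_integrable_paths_weight[of "\<lambda>s. exp (lam * s)"] square_integrable_paths_weight[of vy]
      square_integrable_paths_weight[of "\<lambda>s. - vz s"]
      square_integrable_cmult square_integrable_paths square_integrable_paths_\<beta>
      square_integrable_paths_linear square_integrable_paths_final assms v_cont continuous_intros)

lemma integral_integrand:
  assumes \<omega>: "\<omega> \<in> space M" and "0 \<le> T"
  shows "(\<integral>s. integrand T s \<omega> \<partial>lborel_on T) =
    exp (lam * T) * (sqnorm T \<omega> + 2 * \<sigma> * \<beta> T \<omega> * p T \<omega>) - (sqnorm 0 \<omega> + 2 * \<sigma> * \<beta> T \<omega> * p 0 \<omega>)"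
proof -
  define F where "F s = exp (lam * s) * (sqnorm s \<omega> + 2 * \<sigma> * \<beta> T \<omega> * p s \<omega>)" for s
  have "(\<integral>s. integrand T s \<omega> \<partial>lborel_on T) = F T - F 0"
  proof (rule integral_FTC_lborel_on[OF \<open>0 \<le> T\<close>])
    fix s :: real assume "0 \<le> s"
    show "(F has_real_derivative integrand T s \<omega>) (at s within {0..})"
      unfolding F_def sqnorm_def drift_def integrand_def
      by (rule derivative_eq_intros derivs[OF \<omega> \<open>0 \<le> s\<close>] refl | simp add: algebra_simps)+
  next
    show "continuous_on {0..T} (\<lambda>s. integrand T s \<omega>)"
      unfolding integrand_def sqnorm_def drift_def
      by (intro continuous_intros conts[OF \<omega>] continuous_derivs[OF \<omega>])
  qed
  then show ?thesis by (simp add: F_def)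
qed

text \<open>Replacing \<open>\<beta> T\<close> by \<open>\<beta> s\<close> changes the integrand by
  a multiple of \<open>(\<beta> T - \<beta> s) * h\<close>, where \<open>h\<close> is linear in the
  state at time \<open>s\<close>; its expectation vanishes by orthogonality. For the rest,
  \<open>dissipation\<close> leaves \<open>- lam * \<sigma>^2\<close> times the second moment of
  \<open>\<beta> s\<close>.\<close>

lemma expectation_integrand_le:
  assumes "0 \<le> s" "s \<le> T"
  shows "expectation (integrand T s) \<le> - lam * \<sigma>\<^sup>2 * s * exp (lam * s)"
proof -
  define h where "h \<omega> = lam * p s \<omega> + dp s \<omega>" for \<omega>
  have "0 \<le> T" using assms by simp
  have sh: "square_integrable M h"
    unfolding h_def[abs_def] using \<open>0 \<le> s\<close>
    by (intro square_integrable_add square_integrable_cmult square_integrable_coords square_integrable_linear)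
  have h: "h \<omega> = (lam - \<alpha> - 1 / \<eta>) * p s \<omega> + \<alpha> * q s \<omega> + (- \<alpha> - 1 / \<eta>) * \<sigma> * \<beta> s \<omega>" for \<omega>
    unfolding h_def dp_linear x_def by (simp add: algebra_simps)
  \<comment> \<open>The factor 1 is square integrable on a probability space, so integrability of
    \<open>h\<close> follows from the rule for products.\<close>
  have "integrable M (\<lambda>\<omega>. 1 * h \<omega>)"
    using sh by (intro square_integrable_mult) (simp_all add: square_integrable_def)
  then have orth: "expectation (\<lambda>\<omega>. (\<beta> T \<omega> - \<beta> s \<omega>) * h \<omega>) = 0"
    unfolding h using orthogonal_increment[OF assms] by simp
  have int: "integrable M (\<lambda>\<omega>. (\<beta> T \<omega> - \<beta> s \<omega>) * h \<omega>)"
    using square_integrable_add[OF square_integrable_coords(1)[OF \<open>0 \<le> T\<close>]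
        square_integrable_cmult[OF square_integrable_coords(1)[OF \<open>0 \<le> s\<close>], of "- 1"]] sh
    by (auto dest: square_integrable_mult)
  have le: "integrand T s \<omega> \<le> - lam * \<sigma>\<^sup>2 * exp (lam * s) * (\<beta> s \<omega>)\<^sup>2
      + 2 * \<sigma> * exp (lam * s) * ((\<beta> T \<omega> - \<beta> s \<omega>) * h \<omega>)" for \<omega>
  proof -
    have "lam * sqnorm s \<omega> + drift s \<omega> + 2 * \<sigma> * \<beta> s \<omega> * h \<omega> \<le> - lam * \<sigma>\<^sup>2 * (\<beta> s \<omega>)\<^sup>2"
      using dissipation[of s \<omega>] unfolding h_def by (simp add: algebra_simps)
    then have "exp (lam * s) * (lam * sqnorm s \<omega> + drift s \<omega> + 2 * \<sigma> * \<beta> s \<omega> * h \<omega>)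
        \<le> exp (lam * s) * (- lam * \<sigma>\<^sup>2 * (\<beta> s \<omega>)\<^sup>2)"
      by (rule mult_left_mono) simp
    then show ?thesis
      unfolding integrand_def h_def[symmetric] by (simp add: algebra_simps)
  qed
  have "expectation (integrand T s) \<le> expectation (\<lambda>\<omega>. - lam * \<sigma>\<^sup>2 * exp (lam * s) * (\<beta> s \<omega>)\<^sup>2
      + 2 * \<sigma> * exp (lam * s) * ((\<beta> T \<omega> - \<beta> s \<omega>) * h \<omega>))"
    using integrable_integrand[OF \<open>0 \<le> s\<close> \<open>0 \<le> T\<close>] int integrable_\<beta>_squared[OF \<open>0 \<le> s\<close>] le
    by (intro integral_mono) auto
  also have "\<dots> = - lam * \<sigma>\<^sup>2 * exp (lam * s) * s"
    using int integrable_\<beta>_squared[OF \<open>0 \<le> s\<close>] expectation_\<beta>_squared[OF \<open>0 \<le> s\<close>] orth by simp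
  finally show ?thesis by (simp add: mult.commute mult.left_commute)
qed

lemma expectation_integral_integrand_le:
  assumes "0 \<le> T"
  shows "integrable M (\<lambda>\<omega>. \<integral>s. integrand T s \<omega> \<partial>lborel_on T)"
    and "expectation (\<lambda>\<omega>. \<integral>s. integrand T s \<omega> \<partial>lborel_on T)
      \<le> \<sigma>\<^sup>2 / lam * (exp (lam * T) - 1) - \<sigma>\<^sup>2 * T * exp (lam * T)"
proof -
  interpret pair_sigma_finite "lborel_on T" M by (rule pair_sigma_finite_paths)
  note int = integrable_paths_integrand[OF assms]
  show "integrable M (\<lambda>\<omega>. \<integral>s. integrand T s \<omega> \<partial>lborel_on T)"
    using int by (rule integrable_snd)
  have c: "continuous_on A (\<lambda>s. - lam * \<sigma>\<^sup>2 * s * exp (lam * s))" for A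
    by (intro continuous_intros)
  have "expectation (\<lambda>\<omega>. \<integral>s. integrand T s \<omega> \<partial>lborel_on T)
      = (\<integral>s. expectation (integrand T s) \<partial>lborel_on T)"
    using int by (rule Fubini_integral)
  also have "\<dots> \<le> (\<integral>s. - lam * \<sigma>\<^sup>2 * s * exp (lam * s) \<partial>lborel_on T)"
    using integrable_fst[OF int] integrable_continuous_lborel_on[OF c] expectation_integrand_le
    by (intro integral_mono) (auto simp: space_restrict_space)
  \<comment> \<open>The antiderivative is found by integrating \<open>s * exp (lam * s)\<close> by
    parts.\<close>
  also have "\<dots> = (\<sigma>\<^sup>2 / lam * exp (lam * T) - \<sigma>\<^sup>2 * T * exp (lam * T))
      - (\<sigma>\<^sup>2 / lam * exp (lam * 0) - \<sigma>\<^sup>2 * 0 * exp (lam * 0))"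
    by (rule integral_FTC_lborel_on[OF assms _ c])
      (use lam_pos in \<open>auto intro!: derivative_eq_intros simp: field_simps\<close>)
  finally show "expectation (\<lambda>\<omega>. \<integral>s. integrand T s \<omega> \<partial>lborel_on T)
      \<le> \<sigma>\<^sup>2 / lam * (exp (lam * T) - 1) - \<sigma>\<^sup>2 * T * exp (lam * T)"
    by (simp add: algebra_simps diff_divide_distrib)
qed

text \<open>The term \<sigma>^2 \<beta>(T)^2 left out of the weighted derivative contributes
  \<open>exp (lam * T) * \<sigma>^2 * T\<close> in expectation. This cancels the negative term in
  \<open>expectation_integral_integrand_le\<close>, and what remains is the stationary variance
  \<open>\<sigma>^2 / lam\<close> with its exponential transient.\<close>

lemma mean_square_error:
  assumes T: "0 \<le> T"
  shows "integrable M (\<lambda>\<omega>. (p T \<omega> + \<sigma> * \<beta> T \<omega>)\<^sup>2 + (q T \<omega>)\<^sup>2 + (z T \<omega>)\<^sup>2)"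
    and "expectation (\<lambda>\<omega>. (p T \<omega> + \<sigma> * \<beta> T \<omega>)\<^sup>2 + (q T \<omega>)\<^sup>2 + (z T \<omega>)\<^sup>2)
      \<le> exp (- lam * T) * (p0\<^sup>2 + q0\<^sup>2 + z0\<^sup>2) + \<sigma>\<^sup>2 / lam * (1 - exp (- lam * T))"
proof -
  let ?e = "\<lambda>\<omega>. (p T \<omega> + \<sigma> * \<beta> T \<omega>)\<^sup>2 + (q T \<omega>)\<^sup>2 + (z T \<omega>)\<^sup>2"
  show int: "integrable M ?e"
    using square_integrable_linear(1)[OF T] square_integrable_coords[OF T]
    by (auto simp: square_integrable_def x_def)
  define I where "I \<omega> = (\<integral>s. integrand T s \<omega> \<partial>lborel_on T)" for \<omega>
  note I = expectation_integral_integrand_le[OF T, folded I_def]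
  have \<beta>: "integrable M (\<beta> T)"
    using square_integrable_mult[OF square_integrable_coords(1)[OF T], of "\<lambda>_. 1"]
    by (simp add: square_integrable_def)
  have meas_e: "(\<lambda>\<omega>. exp (lam * T) * ?e \<omega>) \<in> borel_measurable M"
    using meas by measurable
  \<comment> \<open>Almost surely \<open>p 0\<close> is the constant \<open>p0\<close>, so the
    initial cross term is a constant times \<open>\<beta> T\<close> and has mean zero.\<close>
  have eq: "AE \<omega> in M. exp (lam * T) * ?e \<omega> = I \<omega> + (p0\<^sup>2 + q0\<^sup>2 + z0\<^sup>2) + 2 * \<sigma> * p0 * \<beta> T \<omega>
      + exp (lam * T) * \<sigma>\<^sup>2 * (\<beta> T \<omega>)\<^sup>2"
    using sqnorm_init init(1) AE_space
  proof eventually_elim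
    case (elim \<omega>)
    then show ?case
      using integral_integrand[OF _ T, of \<omega>] unfolding I_def sqnorm_def[of T]
      by (simp add: algebra_simps power2_eq_square)
  qed
  have "exp (lam * T) * expectation ?e = expectation (\<lambda>\<omega>. exp (lam * T) * ?e \<omega>)"
    by simp
  also have "\<dots> = expectation (\<lambda>\<omega>. I \<omega> + (p0\<^sup>2 + q0\<^sup>2 + z0\<^sup>2) + 2 * \<sigma> * p0 * \<beta> T \<omega>
      + exp (lam * T) * \<sigma>\<^sup>2 * (\<beta> T \<omega>)\<^sup>2)"
    using I(1) \<beta> integrable_\<beta>_squared[OF T] by (intro integral_cong_AE meas_e eq) auto
  also have "\<dots> = expectation I + (p0\<^sup>2 + q0\<^sup>2 + z0\<^sup>2) + exp (lam * T) * \<sigma>\<^sup>2 * T"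
    using I(1) \<beta> integrable_\<beta>_squared[OF T] expectation_\<beta>[OF T] expectation_\<beta>_squared[OF T]
    by (simp add: prob_space)
  also have "\<dots> \<le> (p0\<^sup>2 + q0\<^sup>2 + z0\<^sup>2) + \<sigma>\<^sup>2 / lam * (exp (lam * T) - 1)"
    using I(2) by (simp add: algebra_simps)
  finally have "exp (- lam * T) * (exp (lam * T) * expectation ?e)
      \<le> exp (- lam * T) * ((p0\<^sup>2 + q0\<^sup>2 + z0\<^sup>2) + \<sigma>\<^sup>2 / lam * (exp (lam * T) - 1))"
    by (rule mult_left_mono) simp
  moreover have "exp (- lam * T) * (exp (lam * T) * expectation ?e) = expectation ?e"
    by (simp add: mult.assoc[symmetric] exp_add[symmetric])
  moreover have "exp (- lam * T) * (a + s * (exp (lam * T) - 1)) = exp (- lam * T) * a + s * (1 - exp (- lam * T))" for a s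
  proof -
    have "exp (- lam * T) * exp (lam * T) = 1"
      by (simp add: exp_add[symmetric])
    then show ?thesis by algebra
  qed
  ultimately show "expectation ?e
      \<le> exp (- lam * T) * (p0\<^sup>2 + q0\<^sup>2 + z0\<^sup>2) + \<sigma>\<^sup>2 / lam * (1 - exp (- lam * T))"
    by (simp only:)
qed

end

section \<open>Brownian increments and the filter equation\<close>

lemma (in prob_space) indep_set_commute: "indep_set A B \<Longrightarrow> indep_set B A"
  unfolding indep_sets2_eq by (metis Int_commute mult.commute)

text \<open>The increment is centred and independent of the past, so the expectation of the product
  factorizes. The work lies in passing from independence of the vector increment to that of one
  coordinate and of \<open>h\<close>.\<close>

lemma (in prob_space) brownian_increment_orthogonal:
  fixes w :: "real \<Rightarrow> 'a \<Rightarrow> real^'n" and h :: "'a \<Rightarrow> real"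
  assumes F: "space (F s) = space M" "sets (F s) \<subseteq> sets M"
    and w: "standard_brownian_motion M F w" and st: "0 \<le> s" "s < t"
    and h: "h \<in> borel_measurable (F s)" "integrable M h"
  shows "expectation (\<lambda>\<omega>. (w t \<omega> - w s \<omega>) $ i * h \<omega>) = 0"
proof (rule expectation_centered_indep_mult)
  \<comment> \<open>The \<sigma>-algebra generated by the vector increment; the preimages under any
    single coordinate belong to it.\<close>
  let ?V = "vimage_algebra (space M) (\<lambda>\<omega>. w t \<omega> - w s \<omega>) borel"
  have dist: "distributed M lborel (\<lambda>\<omega>. (w t \<omega> - w s \<omega>) $ i) (normal_density 0 (sqrt (t - s)))"
    and indep: "indep_set (sets (F s)) {(\<lambda>\<omega>. w t \<omega> - w s \<omega>) -` C \<inter> space M | C. C \<in> sets borel}"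
    using w st unfolding standard_brownian_motion_def by auto
  show inc: "integrable M (\<lambda>\<omega>. (w t \<omega> - w s \<omega>) $ i)" "expectation (\<lambda>\<omega>. (w t \<omega> - w s \<omega>) $ i) = 0"
    using normal_distributed_moments[OF _ dist] st by auto
  show "integrable M h" by fact
  have V: "sets ?V = {(\<lambda>\<omega>. w t \<omega> - w s \<omega>) -` C \<inter> space M | C. C \<in> sets borel}"
    by (rule sets_vimage_algebra2) auto
  have "indep_set (sets ?V) (sets (F s))"
    using indep unfolding V by (rule indep_set_commute)
  then have "indep_set (sigma_sets (space M) {(\<lambda>\<omega>. (w t \<omega> - w s \<omega>) $ i) -` A \<inter> space M | A. A \<in> sets borel})
      (sigma_sets (space M) {h -` A \<inter> space M | A. A \<in> sets borel})"
    unfolding indep_set_def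
  proof (rule indep_sets_mono_sets)
    fix j :: bool
    have "sigma_sets (space ?V) {(\<lambda>\<omega>. (w t \<omega> - w s \<omega>) $ i) -` A \<inter> space M | A. A \<in> sets borel} \<subseteq> sets ?V"
    proof (rule sets.sigma_sets_subset, safe)
      fix A :: "real set" assume "A \<in> sets borel"
      have "(\<lambda>x::real^'n. x $ i) -` A \<inter> space borel \<in> sets borel"
        by (rule measurable_sets[OF borel_measurable_continuous_onI \<open>A \<in> sets borel\<close>])
          (intro continuous_intros)
      then show "(\<lambda>\<omega>. (w t \<omega> - w s \<omega>) $ i) -` A \<inter> space M \<in> sets ?V"
        unfolding V by (auto intro!: exI[of _ "(\<lambda>x::real^'n. x $ i) -` A"])
    qed
    moreover have "sigma_sets (space (F s)) {h -` A \<inter> space M | A. A \<in> sets borel} \<subseteq> sets (F s)"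
      using measurable_sets[OF h(1)] by (intro sets.sigma_sets_subset) (auto simp: F)
    ultimately show "case_bool (sigma_sets (space M) {(\<lambda>\<omega>. (w t \<omega> - w s \<omega>) $ i) -` A \<inter> space M | A. A \<in> sets borel})
      (sigma_sets (space M) {h -` A \<inter> space M | A. A \<in> sets borel}) j
      \<subseteq> case_bool (sets ?V) (sets (F s)) j"
      by (cases j) (simp_all add: F)
  qed
  then show "indep_var borel (\<lambda>\<omega>. (w t \<omega> - w s \<omega>) $ i) borel h"
    unfolding indep_var_eq using inc(1) h(2) by auto
qed

text \<open>Once the noise is subtracted, the filter path is an initial value plus the integral of a
  continuous function, hence continuously differentiable. The difference of the two vector fields
  then expands by bilinearity: B(m, m) - B(v, v) = B(\<delta>, \<delta>) + 2 B(v, \<delta>).\<close>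

lemma threedvar_error_derivatives:
  fixes v w m :: "real \<Rightarrow> real^3"
  assumes v: "lorenz_solution \<alpha> b r v" and m: "continuous_on {0..} m"
    and eq: "\<And>t. 0 \<le> t \<Longrightarrow> m t = m 0
      + integral {0..t} (\<lambda>s. - (lorenz_A \<alpha> b *v m s) - lorenz_B (m s) (m s)
          + lorenz_f \<alpha> b r + (1 / \<eta>) *\<^sub>R (proj_P *v (v s - m s)))
      + \<sigma> *\<^sub>R (proj_P *v (w t - w 0))"
    and t: "0 \<le> t"
  defines "\<delta> \<equiv> \<lambda>s i. m s $ i - v s $ i"
  shows "((\<lambda>s. \<delta> s 1 - \<sigma> * (w s - w 0) $ 1) has_real_derivative
      (- \<alpha> * \<delta> t 1 + \<alpha> * \<delta> t 2 - \<delta> t 1 / \<eta>)) (at t within {0..})"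
    "((\<lambda>s. \<delta> s 2) has_real_derivative
      (- \<alpha> * \<delta> t 1 - \<delta> t 2 - (\<delta> t 1 * \<delta> t 3 + v t $ 1 * \<delta> t 3 + v t $ 3 * \<delta> t 1))) (at t within {0..})"
    "((\<lambda>s. \<delta> s 3) has_real_derivative
      (- b * \<delta> t 3 + (\<delta> t 1 * \<delta> t 2 + v t $ 1 * \<delta> t 2 + v t $ 2 * \<delta> t 1))) (at t within {0..})"
proof -
  define L where "L u = - (lorenz_A \<alpha> b *v u) - lorenz_B u u + lorenz_f \<alpha> b r" for u
  define R where "R s = L (m s) + (1 / \<eta>) *\<^sub>R (proj_P *v (v s - m s))" for s
  define y where "y s = m s - \<sigma> *\<^sub>R (proj_P *v (w s - w 0))" for s
  have dv: "(v has_vector_derivative L (v s)) (at s within {0..})" if "0 \<le> s" for s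
    using v that unfolding lorenz_solution_def L_def by simp
  have cv: "continuous_on {0..} v"
    using dv by (auto intro!: continuous_on_vector_derivative)
  note L_nth = lorenz_rhs_nth[of \<alpha> b _ r, folded L_def]
  have R_nth: "R s $ 1 = - \<alpha> * m s $ 1 + \<alpha> * m s $ 2 + (v s $ 1 - m s $ 1) / \<eta>"
    "R s $ 2 = - \<alpha> * m s $ 1 - m s $ 2 - m s $ 1 * m s $ 3"
    "R s $ 3 = - b * m s $ 3 + m s $ 1 * m s $ 2 - b * (r + \<alpha>)" for s
    by (simp_all add: R_def L_nth proj_P_mult_nth)
  have cR: "continuous_on {0..} (\<lambda>s. R s)"
  proof -
    have "continuous_on {0..} (\<lambda>s. R s $ i)" for i
      using exhaust_3[of i]
      by (elim disjE; simp only: R_nth divide_inverse; intro continuous_intros m cv)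
    then have "continuous_on {0..} (\<lambda>s. \<chi> i. R s $ i)"
      by (rule continuous_on_vec_lambda)
    then show ?thesis by simp
  qed
  have yR: "y s = m 0 + integral {0..s} R" if "0 \<le> s" for s
    using eq[OF that] unfolding y_def R_def[abs_def] L_def by simp
  \<comment> \<open>The derivative of the integral is taken on a compact interval reaching beyond
    \<open>t\<close>, so that near \<open>t\<close> it agrees with the half-line
    \<open>{0..}\<close>.\<close>
  have "((\<lambda>s. m 0 + integral {0..s} R) has_vector_derivative R t) (at t within {0..t + 1})"
    using integral_has_vector_derivative[OF continuous_on_subset[OF cR], of 0 "t + 1" t] t
    by (auto intro!: derivative_eq_intros)
  then have "(y has_vector_derivative R t) (at t within {0..t + 1})"
    by (rule has_vector_derivative_transform[rotated 2]) (use t yR in auto)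
  moreover have "at t within {0..t + 1} = at t within {0..}"
    by (rule at_within_nhd[of _ "{..<t + 1}"]) (use t in auto)
  ultimately have "((\<lambda>s. y s - v s) has_vector_derivative R t - L (v t)) (at t within {0..})"
    using dv[OF t] by (auto intro!: derivative_eq_intros)
  note d = this[THEN has_real_derivative_nth]
  have y: "(y s - v s) $ 1 = \<delta> s 1 - \<sigma> * (w s - w 0) $ 1" "(y s - v s) $ 2 = \<delta> s 2"
    "(y s - v s) $ 3 = \<delta> s 3" for s
    by (simp_all add: y_def \<delta>_def proj_P_mult_nth)
  have "(R t - L (v t)) $ 1 = - \<alpha> * \<delta> t 1 + \<alpha> * \<delta> t 2 - \<delta> t 1 / \<eta>"
    unfolding vector_minus_component R_nth L_nth \<delta>_def
    by (simp add: algebra_simps diff_divide_distrib)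
  with d[of 1] show "((\<lambda>s. \<delta> s 1 - \<sigma> * (w s - w 0) $ 1) has_real_derivative
      (- \<alpha> * \<delta> t 1 + \<alpha> * \<delta> t 2 - \<delta> t 1 / \<eta>)) (at t within {0..})"
    unfolding y by (simp only:)
  have "(R t - L (v t)) $ 2 = - \<alpha> * \<delta> t 1 - \<delta> t 2 - (\<delta> t 1 * \<delta> t 3 + v t $ 1 * \<delta> t 3 + v t $ 3 * \<delta> t 1)"
    unfolding vector_minus_component R_nth L_nth \<delta>_def
    by (simp add: algebra_simps)
  with d[of 2] show "((\<lambda>s. \<delta> s 2) has_real_derivative
      (- \<alpha> * \<delta> t 1 - \<delta> t 2 - (\<delta> t 1 * \<delta> t 3 + v t $ 1 * \<delta> t 3 + v t $ 3 * \<delta> t 1))) (at t within {0..})"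
    unfolding y by (simp only:)
  have "(R t - L (v t)) $ 3 = - b * \<delta> t 3 + (\<delta> t 1 * \<delta> t 2 + v t $ 1 * \<delta> t 2 + v t $ 2 * \<delta> t 1)"
    unfolding vector_minus_component R_nth L_nth \<delta>_def
    by (simp add: algebra_simps)
  with d[of 3] show "((\<lambda>s. \<delta> s 3) has_real_derivative
      (- b * \<delta> t 3 + (\<delta> t 1 * \<delta> t 2 + v t $ 1 * \<delta> t 2 + v t $ 2 * \<delta> t 1))) (at t within {0..})"
    unfolding y by (simp only:)
qed

section \<open>From the filter to the error model, and the passage to the limit\<close>

theorem theorem4p1:
  fixes \<alpha> b r \<epsilon> \<eta> K lam :: real
    and \<A> :: "(real^3) set"
    and v :: "real \<Rightarrow> real^3"
    and M :: "'a measure"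
    and F :: "real \<Rightarrow> 'a measure"
    and w m :: "real \<Rightarrow> 'a \<Rightarrow> real^3"
    and m0 :: "real^3"
  assumes "\<alpha> > 1" and "b > 1" and "r > 0"
    and "\<epsilon> > 0" and "\<eta> > 0"
    and K: "K = b^2 * (r + \<alpha>)^2 / (4 * (b - 1))"
    and lam: "lam = 2 * (1 - \<eta> * K / 4)"
    and attractor: "lorenz_global_attractor \<alpha> b r \<A>"
    and v: "lorenz_solution \<alpha> b r v" "v 0 \<in> \<A>"
    and "prob_space M"
    and filtration: "filtration (space M) F" "\<And>t. sets (F t) \<subseteq> sets M"
    and w: "standard_brownian_motion M F w"
    and m: "threedvar_solution \<alpha> b r \<epsilon> \<eta> M F w v m"
    and m0: "AE \<omega> in M. m 0 \<omega> = m0"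
    and "\<eta> * K < 4"
  shows "(\<forall>t\<ge>0.
            integrable M (\<lambda>\<omega>. (norm (m t \<omega> - v t))^2) \<and>
            prob_space.expectation M (\<lambda>\<omega>. (norm (m t \<omega> - v t))^2)
              \<le> exp (- lam * t) * (norm (m0 - v 0))^2
                 + \<epsilon>^2 / (\<eta>^2 * lam) * (1 - exp (- lam * t)))
       \<and> Limsup at_top
            (\<lambda>t. ereal (prob_space.expectation M (\<lambda>\<omega>. (norm (m t \<omega> - v t))^2)))
            \<le> ereal (\<epsilon>^2 / (lam * \<eta>^2))"
proof -
  interpret prob_space M by fact
  define \<sigma> where "\<sigma> = \<epsilon> / \<eta>"
  have F: "space (F s) = space M" "sets (F s) \<subseteq> sets M" for s
    using filtration(2) filtration.space_F[OF filtration(1)] by auto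
  have F_mono: "sets (F s) \<subseteq> sets (F t)" if "s \<le> t" for s t
    using filtration.sets_F_mono[OF filtration(1) that] .
  have v_in: "v s \<in> \<A>" if "0 \<le> s" for s
    using attractor v that unfolding lorenz_global_attractor_def lorenz_flow_image_def by blast
  have v_bound: "(norm (v s))\<^sup>2 \<le> K" if "0 \<le> s" for s
    using lorenz_attractor_norm_bound[OF assms(1,2) attractor v_in[OF that]] K by simp
  have v_cont: "continuous_on {0..} v"
    using v(1) unfolding lorenz_solution_def by (auto intro!: continuous_on_vector_derivative)
  have w_meas: "w s \<in> borel_measurable (F t)" if "0 \<le> s" "s \<le> t" for s t
    using w that F_mono[OF that(2)] F unfolding standard_brownian_motion_def
    by (auto intro!: measurable_from_subalg[of "F t" "F s"] simp: subalgebra_def)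
  have m_meas: "m s \<in> borel_measurable (F s)" if "0 \<le> s" for s
    using m that unfolding threedvar_solution_def by auto
  have F_le: "f \<in> borel_measurable M" if "f \<in> borel_measurable (F s)" for f :: "'a \<Rightarrow> real" and s
    using that F by (auto intro!: measurable_from_subalg[of M "F s"] simp: subalgebra_def)
  have nth_meas: "(\<lambda>\<omega>. f \<omega> $ i) \<in> borel_measurable N"
    if "f \<in> borel_measurable N" for f :: "'a \<Rightarrow> real^3" and i N
    using that by (rule measurable_compose)
      (intro borel_measurable_continuous_onI continuous_intros)
  define good where "good \<omega> \<longleftrightarrow> continuous_on {0..} (\<lambda>t. w t \<omega>) \<and> continuous_on {0..} (\<lambda>t. m t \<omega>) \<and>
     (\<forall>t\<ge>0. m t \<omega> = m 0 \<omega>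
          + integral {0..t} (\<lambda>s. - (lorenz_A \<alpha> b *v m s \<omega>) - lorenz_B (m s \<omega>) (m s \<omega>)
              + lorenz_f \<alpha> b r + (1 / \<eta>) *\<^sub>R (proj_P *v (v s - m s \<omega>)))
          + \<sigma> *\<^sub>R (proj_P *v (w t \<omega> - w 0 \<omega>)))" for \<omega>
  have "AE \<omega> in M. good \<omega>"
    using w m unfolding standard_brownian_motion_def threedvar_solution_def good_def \<sigma>_def
    by (auto simp: AE_conj_iff)
  \<comment> \<open>All almost sure path properties are collected outside one measurable null set,
    so that altering the processes on it preserves measurability.\<close>
  then obtain N where N: "N \<in> null_sets M" "{\<omega> \<in> space M. \<not> good \<omega>} \<subseteq> N"
    unfolding eventually_ae_filter by auto
  have AE_N: "AE \<omega> in M. \<omega> \<notin> N"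
    using N(1) by (rule AE_not_in)
  have good: "good \<omega>" if "\<omega> \<in> space M" "\<omega> \<notin> N" for \<omega>
    using N(2) that by auto
  have [measurable]: "N \<in> sets M" using N(1) by auto
  define bm where "bm s \<omega> = (w s \<omega> - w 0 \<omega>) $ 1" for s \<omega>
  define \<delta> where "\<delta> s \<omega> i = m s \<omega> $ i - v s $ i" for s \<omega> and i :: 3
  \<comment> \<open>On the null set \<open>N\<close> all processes are set to 0, which still solves the error equations, and
    times are clamped at 0; this gives continuous paths on all of \<open>\<real>\<close> for every outcome.\<close>
  define \<beta> where "\<beta> s \<omega> = (if \<omega> \<in> N then 0 else bm (max 0 s) \<omega>)" for s \<omega>
  define p where "p s \<omega> = (if \<omega> \<in> N then 0 else \<delta> (max 0 s) \<omega> 1 - \<sigma> * bm (max 0 s) \<omega>)" for s \<omega>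
  define q where "q s \<omega> = (if \<omega> \<in> N then 0 else \<delta> (max 0 s) \<omega> 2)" for s \<omega>
  define z where "z s \<omega> = (if \<omega> \<in> N then 0 else \<delta> (max 0 s) \<omega> 3)" for s \<omega>
  note mod_defs = \<beta>_def p_def q_def z_def
  have bm_meas: "bm s \<in> borel_measurable (F s)" if "0 \<le> s" for s
    unfolding bm_def[abs_def] using that by (intro nth_meas borel_measurable_diff w_meas) auto
  have \<delta>_meas: "(\<lambda>\<omega>. \<delta> s \<omega> i) \<in> borel_measurable (F s)" if "0 \<le> s" for s i
    unfolding \<delta>_def using that by (intro borel_measurable_diff nth_meas m_meas) auto
  have extend: "continuous_on UNIV (\<lambda>s. f (max 0 s))" if "continuous_on {0..} f" for f :: "real \<Rightarrow> real"
    by (rule continuous_on_compose2[OF that]) (auto intro!: continuous_intros)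
  have extend_deriv: "((\<lambda>s. f (max 0 s)) has_real_derivative D) (at s within {0..})"
    if "(f has_real_derivative D) (at s within {0..})" "0 \<le> s" for f D and s :: real
    by (rule has_field_derivative_transform_within[OF that(1), of 1]) (use that in auto)
  have deriv: "((\<lambda>s. \<delta> s \<omega> 1 - \<sigma> * bm s \<omega>) has_real_derivative
      (- \<alpha> * \<delta> t \<omega> 1 + \<alpha> * \<delta> t \<omega> 2 - \<delta> t \<omega> 1 / \<eta>)) (at t within {0..})"
    "((\<lambda>s. \<delta> s \<omega> 2) has_real_derivative
      (- \<alpha> * \<delta> t \<omega> 1 - \<delta> t \<omega> 2 - (\<delta> t \<omega> 1 * \<delta> t \<omega> 3 + v t $ 1 * \<delta> t \<omega> 3 + v t $ 3 * \<delta> t \<omega> 1)))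
      (at t within {0..})"
    "((\<lambda>s. \<delta> s \<omega> 3) has_real_derivative
      (- b * \<delta> t \<omega> 3 + (\<delta> t \<omega> 1 * \<delta> t \<omega> 2 + v t $ 1 * \<delta> t \<omega> 2 + v t $ 2 * \<delta> t \<omega> 1)))
      (at t within {0..})"
    if "\<omega> \<in> space M" "\<omega> \<notin> N" "0 \<le> t" for \<omega> t
    using threedvar_error_derivatives[OF v(1), where m = "\<lambda>s. m s \<omega>" and w = "\<lambda>s. w s \<omega>" and \<eta> = \<eta> and \<sigma> = \<sigma> and t = t]
      good[OF that(1,2)] that(3)
    unfolding good_def \<delta>_def bm_def by blast+
  have bm_moments: "integrable M (bm s)" "expectation (bm s) = 0" "integrable M (\<lambda>\<omega>. (bm s \<omega>)\<^sup>2)"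
    "expectation (\<lambda>\<omega>. (bm s \<omega>)\<^sup>2) = s" if "0 \<le> s" for s
  proof -
    have "integrable M (bm s) \<and> expectation (bm s) = 0 \<and> integrable M (\<lambda>\<omega>. (bm s \<omega>)\<^sup>2)
      \<and> expectation (\<lambda>\<omega>. (bm s \<omega>)\<^sup>2) = s"
    \<comment> \<open>The normal law is available for positive durations; at time 0 the increment is
      identically 0.\<close>
    proof (cases "s = 0")
      case True
      then show ?thesis by (simp add: bm_def[abs_def])
    next
      case False
      then have "0 < s" using that by simp
      then have "distributed M lborel (bm s) (normal_density 0 (sqrt (s - 0)))"
        using w unfolding standard_brownian_motion_def bm_def[abs_def] by blast
      from normal_distributed_moments[OF _ this] \<open>0 < s\<close> show ?thesis by simp
    qed
    then show "integrable M (bm s)" "expectation (bm s) = 0" "integrable M (\<lambda>\<omega>. (bm s \<omega>)\<^sup>2)"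
      "expectation (\<lambda>\<omega>. (bm s \<omega>)\<^sup>2) = s" by blast+
  qed
  have mod_meas: "\<beta> s \<in> borel_measurable M" "p s \<in> borel_measurable M" "q s \<in> borel_measurable M"
    "z s \<in> borel_measurable M" for s
  proof -
    note [measurable] = F_le[OF bm_meas[of "max 0 s"]] F_le[OF \<delta>_meas[of "max 0 s"]]
    show "\<beta> s \<in> borel_measurable M" "p s \<in> borel_measurable M" "q s \<in> borel_measurable M"
      "z s \<in> borel_measurable M"
      unfolding mod_defs[abs_def] by simp_all
  qed
  have \<beta>_eq: "AE \<omega> in M. \<beta> s \<omega> = bm s \<omega>" if "0 \<le> s" for s
    using AE_N by eventually_elim (use that in \<open>simp add: \<beta>_def\<close>)
  have bm_meas_M: "bm s \<in> borel_measurable M" if "0 \<le> s" for s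
    using F_le[OF bm_meas[OF that]] .
  interpret E: lorenz_error M \<alpha> b \<eta> \<sigma> K lam "\<lambda>s. v (max 0 s) $ 1" "\<lambda>s. v (max 0 s) $ 2"
    "\<lambda>s. v (max 0 s) $ 3" \<beta> p q z "(m0 - v 0) $ 1" "(m0 - v 0) $ 2" "(m0 - v 0) $ 3"
  proof unfold_locales
    show "\<alpha> > 1" "b > 1" "\<eta> > 0" "\<eta> * K < 4" "lam = 2 * (1 - \<eta> * K / 4)" by fact+
    show "continuous_on UNIV (\<lambda>s. v (max 0 s) $ 1)" "continuous_on UNIV (\<lambda>s. v (max 0 s) $ 2)"
      "continuous_on UNIV (\<lambda>s. v (max 0 s) $ 3)"
      by (rule extend, rule continuous_on_component[OF v_cont])+
    show "(v (max 0 s) $ 2)\<^sup>2 + (v (max 0 s) $ 3)\<^sup>2 \<le> K" for s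
    proof -
      have "0 \<le> (v (max 0 s) $ 1)\<^sup>2" by simp
      then show ?thesis
        using v_bound[OF max.cobounded1[of 0 s]] norm_vec3_squared[of "v (max 0 s)"] by linarith
    qed
    show "\<beta> s \<in> borel_measurable M" "p s \<in> borel_measurable M" "q s \<in> borel_measurable M"
      "z s \<in> borel_measurable M" for s by (rule mod_meas)+
  next
    fix \<omega> assume \<omega>: "\<omega> \<in> space M"
    have "continuous_on {0..} (\<lambda>s. bm s \<omega>) \<and> (\<forall>i. continuous_on {0..} (\<lambda>s. \<delta> s \<omega> i))" if "\<omega> \<notin> N"
      using good[OF \<omega> that] v_cont unfolding good_def bm_def \<delta>_def by (auto intro!: continuous_intros)
    then show "continuous_on UNIV (\<lambda>s. \<beta> s \<omega>)" "continuous_on UNIV (\<lambda>s. p s \<omega>)"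
      "continuous_on UNIV (\<lambda>s. q s \<omega>)" "continuous_on UNIV (\<lambda>s. z s \<omega>)"
      unfolding mod_defs by (cases "\<omega> \<in> N"; auto intro!: continuous_intros extend)+
    fix s :: real assume s: "0 \<le> s"
    show "((\<lambda>s. p s \<omega>) has_real_derivative
        (- \<alpha> * (p s \<omega> + \<sigma> * \<beta> s \<omega>) + \<alpha> * q s \<omega> - (p s \<omega> + \<sigma> * \<beta> s \<omega>) / \<eta>)) (at s within {0..})"
      using extend_deriv[OF deriv(1)[OF \<omega> _ s] s] s unfolding mod_defs
      by (cases "\<omega> \<in> N") simp_all
    show "((\<lambda>s. q s \<omega>) has_real_derivative
        (- \<alpha> * (p s \<omega> + \<sigma> * \<beta> s \<omega>) - q s \<omega> - ((p s \<omega> + \<sigma> * \<beta> s \<omega>) * z s \<omega> + v (max 0 s) $ 1 * z s \<omega>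
          + v (max 0 s) $ 3 * (p s \<omega> + \<sigma> * \<beta> s \<omega>)))) (at s within {0..})"
      using extend_deriv[OF deriv(2)[OF \<omega> _ s] s] s unfolding mod_defs
      by (cases "\<omega> \<in> N") simp_all
    show "((\<lambda>s. z s \<omega>) has_real_derivative
        (- b * z s \<omega> + ((p s \<omega> + \<sigma> * \<beta> s \<omega>) * q s \<omega> + v (max 0 s) $ 1 * q s \<omega>
          + v (max 0 s) $ 2 * (p s \<omega> + \<sigma> * \<beta> s \<omega>)))) (at s within {0..})"
      using extend_deriv[OF deriv(3)[OF \<omega> _ s] s] s unfolding mod_defs
      by (cases "\<omega> \<in> N") simp_all
  next
    show "AE \<omega> in M. p 0 \<omega> = (m0 - v 0) $ 1" "AE \<omega> in M. q 0 \<omega> = (m0 - v 0) $ 2"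
      "AE \<omega> in M. z 0 \<omega> = (m0 - v 0) $ 3"
      using m0 AE_N unfolding mod_defs \<delta>_def bm_def by (eventually_elim; simp)+
  next
    fix s :: real assume s: "0 \<le> s"
    show "expectation (\<beta> s) = 0"
      using integral_cong_AE[OF mod_meas(1) bm_meas_M \<beta>_eq, OF s s] bm_moments(2)[OF s] by simp
    have sq: "AE \<omega> in M. (\<beta> s \<omega>)\<^sup>2 = (bm s \<omega>)\<^sup>2"
      using \<beta>_eq[OF s] by eventually_elim simp
    note [measurable] = mod_meas(1)[of s] bm_meas_M[OF s]
    show "integrable M (\<lambda>\<omega>. (\<beta> s \<omega>)\<^sup>2)"
      using integrable_cong_AE[OF _ _ sq] bm_moments(3)[OF s] by simp
    show "expectation (\<lambda>\<omega>. (\<beta> s \<omega>)\<^sup>2) = s"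
      using integral_cong_AE[OF _ _ sq] bm_moments(4)[OF s] by simp
  next
    fix s t c d e :: real
    assume st: "0 \<le> s" "s \<le> t" and int: "integrable M (\<lambda>\<omega>. c * p s \<omega> + d * q s \<omega> + e * \<beta> s \<omega>)"
    \<comment> \<open>The same combination built from the unmodified processes. Unlike the modified
      ones, these are measurable for \<open>F s\<close> even if \<open>N\<close> is not in
      \<open>F s\<close>, as independence requires; the two versions agree almost
      everywhere.\<close>
    define h where "h \<omega> = c * (\<delta> s \<omega> 1 - \<sigma> * bm s \<omega>) + d * \<delta> s \<omega> 2 + e * bm s \<omega>" for \<omega>
    have h_meas: "h \<in> borel_measurable (F s)"
      unfolding h_def[abs_def] using bm_meas[OF st(1)] \<delta>_meas[OF st(1)] by measurable
    note [measurable] = F_le[OF h_meas] mod_meas bm_meas_M[OF st(1)] bm_meas_M[OF order_trans[OF st]]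
    have h_eq: "AE \<omega> in M. c * p s \<omega> + d * q s \<omega> + e * \<beta> s \<omega> = h \<omega>"
      using AE_N by eventually_elim (use st in \<open>simp add: mod_defs h_def\<close>)
    have int_h: "integrable M h"
      using integrable_cong_AE[OF _ _ h_eq] int by simp
    show "expectation (\<lambda>\<omega>. (\<beta> t \<omega> - \<beta> s \<omega>) * (c * p s \<omega> + d * q s \<omega> + e * \<beta> s \<omega>)) = 0"
    proof (cases "s = t")
      case False
      have "AE \<omega> in M. (\<beta> t \<omega> - \<beta> s \<omega>) * (c * p s \<omega> + d * q s \<omega> + e * \<beta> s \<omega>) = (bm t \<omega> - bm s \<omega>) * h \<omega>"
        using h_eq \<beta>_eq[OF st(1)] \<beta>_eq[OF order_trans[OF st]] by eventually_elim simp
      then have "expectation (\<lambda>\<omega>. (\<beta> t \<omega> - \<beta> s \<omega>) * (c * p s \<omega> + d * q s \<omega> + e * \<beta> s \<omega>))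
          = expectation (\<lambda>\<omega>. (bm t \<omega> - bm s \<omega>) * h \<omega>)"
        by (rule integral_cong_AE[rotated 2]) measurable
      also have "\<dots> = expectation (\<lambda>\<omega>. (w t \<omega> - w s \<omega>) $ 1 * h \<omega>)"
        by (simp add: bm_def)
      also have "\<dots> = 0"
        using st False by (intro brownian_increment_orthogonal[OF F w st(1) _ h_meas int_h]) simp
      finally show ?thesis .
    qed simp
  qed
  have mse: "integrable M (\<lambda>\<omega>. (norm (m t \<omega> - v t))^2) \<and>
      expectation (\<lambda>\<omega>. (norm (m t \<omega> - v t))^2)
        \<le> exp (- lam * t) * (norm (m0 - v 0))^2 + \<epsilon>^2 / (\<eta>^2 * lam) * (1 - exp (- lam * t))"
    if t: "0 \<le> t" for t
  proof -
    have eq: "AE \<omega> in M. (p t \<omega> + \<sigma> * \<beta> t \<omega>)\<^sup>2 + (q t \<omega>)\<^sup>2 + (z t \<omega>)\<^sup>2 = (norm (m t \<omega> - v t))\<^sup>2"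
      using AE_N by eventually_elim (use t in \<open>simp add: mod_defs \<delta>_def norm_vec3_squared\<close>)
    note [measurable] = mod_meas
    have [measurable]: "(\<lambda>\<omega>. (norm (m t \<omega> - v t))\<^sup>2) \<in> borel_measurable M"
      unfolding norm_vec3_squared using F_le[OF \<delta>_meas[OF t]] unfolding \<delta>_def by simp
    have "\<sigma>\<^sup>2 / lam = \<epsilon>\<^sup>2 / (\<eta>\<^sup>2 * lam)"
      by (simp add: \<sigma>_def power_divide)
    then show ?thesis
      using E.mean_square_error[OF t] integrable_cong_AE[OF _ _ eq] integral_cong_AE[OF _ _ eq]
      by (simp add: norm_vec3_squared[of "m0 - v 0"])
  qed
  moreover have "Limsup at_top (\<lambda>t. ereal (expectation (\<lambda>\<omega>. (norm (m t \<omega> - v t))^2)))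
      \<le> ereal (\<epsilon>^2 / (lam * \<eta>^2))"
  proof -
    let ?g = "\<lambda>t. exp (- lam * t) * (norm (m0 - v 0))^2 + \<epsilon>^2 / (\<eta>^2 * lam) * (1 - exp (- lam * t))"
    have "((\<lambda>t. exp (- lam * t)) \<longlongrightarrow> 0) at_top"
      using E.lam_pos by real_asymp
    then have "(?g \<longlongrightarrow> 0 * (norm (m0 - v 0))^2 + \<epsilon>^2 / (\<eta>^2 * lam) * (1 - 0)) at_top"
      by (intro tendsto_intros)
    then have lim: "((\<lambda>t. ereal (?g t)) \<longlongrightarrow> ereal (\<epsilon>^2 / (lam * \<eta>^2))) at_top"
      by (simp add: mult.commute)
    \<comment> \<open>The mean square bound holds for \<open>t \<ge> 0\<close>, hence eventually,
      and its right-hand side converges because \<open>lam\<close> is positive.\<close>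
    have "Limsup at_top (\<lambda>t. ereal (expectation (\<lambda>\<omega>. (norm (m t \<omega> - v t))^2)))
        \<le> Limsup at_top (\<lambda>t. ereal (?g t))"
      by (intro Limsup_mono eventually_mono[OF eventually_ge_at_top[of "0::real"]]) (simp only: ereal_less_eq mse)
    also have "\<dots> = ereal (\<epsilon>^2 / (lam * \<eta>^2))"
      using lim by (intro lim_imp_Limsup) auto
    finally show ?thesis .
  qed
  ultimately show ?thesis by blast
qed

end
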